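(* Let $A,E\in\mathbb{R}^{n\times n}$ and $K(s)=(sE-A)^{-1}$. Assume the pencil $(A,E)$ is regular and let $\alpha,\beta\in\mathbb{C}$ be such that $W:=\alpha E+\beta A$ is invertible. Let $\omega_1,\omega_2\in\mathbb{R}$ and assume $(A,E)$ has no eigenvalue of the form $\mathrm{j}\lambda$ with $\lambda\in[\omega_1,\omega_2]$. For $\epsilon\in\mathbb{C}$ put $A_\epsilon:=A+\alpha\epsilon I$, $E_\epsilon:=E-\beta\epsilon I$, $\tilde\Omega(\omega,\epsilon):=\omega E_\epsilon+\mathrm{j}A_\epsilon$, $\tilde Y_\epsilon:=\log\big(\tilde\Omega(\omega_2,\epsilon)\tilde\Omega(\omega_1,\epsilon)^{-1}\big)$, $\tilde Y:=\lim_{\epsilon\to0}\tilde Y_\epsilon=\log\big(\tilde\Omega(\omega_2,0)\tilde\Omega(\omega_1,0)^{-1}\big)$, and $\tilde L:=\lim_{\epsilon\to0}(e^{\tilde Y_\epsilon}-I)^{-1}\tilde Y_\epsilon=\psi_1(\tilde Y)^{-1}$, where $\psi_1(X)=\sum_{k=0}^\infty\frac{1}{(k+1)!}X^k$. Then $$\int_{\omega_1}^{\omega_2}K(\mathrm{j}\omega)\,d\omega=\lim_{\epsilon\to0}\frac{1}{\mathrm{j}}E_\epsilon^{-1}\log\big(\tilde\Omega(\omega_2,\epsilon)\tilde\Omega(\omega_1,\epsilon)^{-1}\big)=\lim_{\epsilon\to0}\frac{1}{\mathrm{j}}\log\big(\tilde\Omega(\omega_1,\epsilon)^{-1}\tilde\Omega(\omega_2,\epsilon)\big)E_\epsilon^{-1}=-W^{-1}\Big(\beta\tilde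 L(\omega_2I-e^{\tilde Y}\omega_1)+\mathrm{j}\alpha\tilde Y\Big).$$
   Context: $\mathrm{j}=\sqrt{-1}$. A pencil $(A,E)$ is regular if $\alpha E+\beta A$ is invertible for some complex $\alpha,\beta$; $\lambda$ is an eigenvalue of $(A,E)$ if $\det(A-\lambda E)=0$. $\log$ denotes the principal matrix logarithm (eigenvalues with imaginary part in $(-\pi,\pi)$); $e^{\tilde Y}$ is the matrix exponential. *)

theory Defs
  imports "HOL-Analysis.Analysis"
begin


definition cmat :: "real ^ 'n::finite ^ 'n \<Rightarrow> complex ^ 'n ^ 'n" where
  "cmat A = (\<chi> i j. complex_of_real (A $ i $ j))"

definition csm :: "complex \<Rightarrow> (complex ^ 'n::finite ^ 'n) \<Rightarrow> (complex ^ 'n::finite ^ 'n)" where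
  "csm c M = (\<chi> i j. c * M $ i $ j)"

primrec matpow :: "(complex ^ 'n::finite ^ 'n) \<Rightarrow> nat \<Rightarrow> (complex ^ 'n::finite ^ 'n)" where
  "matpow X 0 = mat 1"
| "matpow X (Suc k) = X ** matpow X k"

definition mexp :: "(complex ^ 'n::finite ^ 'n) \<Rightarrow> (complex ^ 'n::finite ^ 'n)" where
  "mexp X = (\<Sum>k. (1 / fact k) *\<^sub>R matpow X k)"

definition psi1 :: "(complex ^ 'n::finite ^ 'n) \<Rightarrow> (complex ^ 'n::finite ^ 'n)" where
  "psi1 X = (\<Sum>k. (1 / fact (k + 1)) *\<^sub>R matpow X k)"

definition is_eigenvalue :: "(complex ^ 'n::finite ^ 'n) \<Rightarrow> complex \<Rightarrow> bool" where
  "is_eigenvalue Y z \<longleftrightarrow> det (Y - csm z (mat 1)) = 0"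

definition mlog :: "(complex ^ 'n::finite ^ 'n) \<Rightarrow> (complex ^ 'n::finite ^ 'n)" where
  "mlog M = (THE Y. mexp Y = M \<and>
      (\<forall>z. is_eigenvalue Y z \<longrightarrow> - pi < Im z \<and> Im z < pi))"

definition pencil_regular :: "(complex ^ 'n::finite ^ 'n) \<Rightarrow> (complex ^ 'n::finite ^ 'n) \<Rightarrow> bool" where
  "pencil_regular A E \<longleftrightarrow> (\<exists>a b. invertible (csm a E + csm b A))"

definition pencil_eigenvalue :: "(complex ^ 'n::finite ^ 'n) \<Rightarrow> (complex ^ 'n::finite ^ 'n) \<Rightarrow> complex \<Rightarrow> bool" where
  "pencil_eigenvalue A E z \<longleftrightarrow> det (A - csm z E) = 0"

end

theory Submission
  imports Defs "HOL-Computational_Algebra.Fundamental_Theorem_Algebra"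
begin

text \<open>
  Write \<open>\<Omega>(t) = t E + \<i> A\<close> for the (perturbed) pencil.  Since
  \<open>\<Omega>(t) \<Omega>(a)\<^sup>-\<^sup>1 = I + (t - a) N\<close> with \<open>N = E \<Omega>(a)\<^sup>-\<^sup>1\<close>, the matrix
  \<open>Z = \<integral> N (I + (t - a) N)\<^sup>-\<^sup>1 dt = E \<integral> \<Omega>(t)\<^sup>-\<^sup>1 dt\<close> over \<open>[a, b]\<close> satisfies
  \<open>e\<^sup>Z = \<Omega>(b) \<Omega>(a)\<^sup>-\<^sup>1\<close>, and its eigenvalues are \<open>Ln (1 + (b - a) \<mu>)\<close> for eigenvalues \<open>\<mu>\<close> of \<open>N\<close>,
  hence lie in the principal strip.  It is the only such logarithm: \<open>Z\<close> commutes with everything that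
  commutes with its exponential, so for another logarithm \<open>Y\<close> we get \<open>e\<^sup>D = I\<close> for \<open>D = Y - Z\<close>, that is
  \<open>D \<psi>\<^sub>1(D) = 0\<close>, and a common eigenvector of \<open>Y\<close> and \<open>Z\<close> in the kernel of \<open>\<psi>\<^sub>1(D)\<close> would give an
  eigenvalue \<open>2 \<pi> \<i> k\<close> of \<open>D\<close> with \<open>k \<noteq> 0\<close>, which the strip excludes.

  The logarithms of the perturbed quotients are thus \<open>E\<^sub>\<epsilon> J\<^sub>\<epsilon>\<close> and \<open>J\<^sub>\<epsilon> E\<^sub>\<epsilon>\<close>, where
  \<open>J\<^sub>\<epsilon> = \<integral> \<Omega>(t, \<epsilon>)\<^sup>-\<^sup>1 dt\<close> depends continuously on \<open>\<epsilon>\<close>, so all limits exist even if \<open>E\<close> is singular.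
  For \<open>\<epsilon> \<noteq> 0\<close> the factor \<open>e\<^sup>Y - I\<close> is invertible, and cancelling it yields
  \<open>\<i> A\<^sub>\<epsilon> J\<^sub>\<epsilon> = L\<^sub>\<epsilon> (b I - a e\<^sup>Y)\<close>; combined with \<open>W = \<alpha> E\<^sub>\<epsilon> + \<beta> A\<^sub>\<epsilon>\<close> this is the closed form.
\<close>

subsection \<open>Exponentials in Banach algebras\<close>

text \<open>Both sides are the exponential series from the quadratic term on, so the bound holds
  termwise. It reduces differentiability at 0 in any Banach algebra to the real exponential.\<close>

lemma norm_exp_remainder_le:
  fixes x :: "'a::{real_normed_algebra_1,banach}"
  shows "norm (exp x - 1 - x) \<le> exp (norm x) - 1 - norm x"
proof -
  let ?a = "\<lambda>n. inverse (fact (n + 2)) *\<^sub>R x ^ (n + 2)"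
  let ?b = "\<lambda>n. inverse (fact (n + 2)) *\<^sub>R norm x ^ (n + 2)"
  have le: "norm (?a n) \<le> ?b n" for n
    using norm_power_ineq[of x "n + 2"] by (simp add: mult_left_mono)
  have sb: "summable ?b"
    using summable_ignore_initial_segment[OF summable_exp_generic[of "norm x"], of 2] by simp
  have "norm (suminf ?a) \<le> (\<Sum>n. norm (?a n))"
    by (rule summable_norm) (rule summable_comparison_test'[OF sb], use le in auto)
  also have "\<dots> \<le> suminf ?b"
    by (rule suminf_le[OF le _ sb]) (rule summable_comparison_test'[OF sb], use le in auto)
  finally show ?thesis
    by (simp add: exp_first_two_terms[of x] exp_first_two_terms[of "norm x"])
qed

lemma exp_has_derivative_at_0:
  "(exp has_derivative (\<lambda>h. h)) (at (0::'a::{real_normed_algebra_1,banach}))"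
proof -
  have lim: "((\<lambda>h. \<bar>exp h - 1 - h\<bar> / \<bar>h\<bar>) \<longlongrightarrow> 0) (at (0::real))"
    using DERIV_exp[of "0::real"] by (simp add: has_field_derivative_def has_derivative_at)
  have nlim: "filterlim (norm :: 'a \<Rightarrow> real) (at 0) (at 0)"
    by (auto simp: filterlim_at tendsto_norm_zero_iff eventually_at_filter intro!: tendsto_eq_intros)
  have "((\<lambda>h::'a. \<bar>exp (norm h) - 1 - norm h\<bar> / norm h) \<longlongrightarrow> 0) (at 0)"
    using filterlim_compose[OF lim nlim] by simp
  then have "((\<lambda>h::'a. norm (exp h - 1 - h) / norm h) \<longlongrightarrow> 0) (at 0)"
  proof (rule Lim_null_comparison[rotated], intro always_eventually allI)
    fix h :: 'a
    show "norm (norm (exp h - 1 - h) / norm h) \<le> \<bar>exp (norm h) - 1 - norm h\<bar> / norm h"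
      using norm_exp_remainder_le[of h] by (simp add: divide_right_mono)
  qed
  then show ?thesis
    by (simp add: has_derivative_at bounded_linear_ident)
qed

text \<open>Commutation of \<open>P s\<close> with \<open>P t\<close> allows
  \<open>exp (P t)\<close> to be written as \<open>exp (P s) * exp (P t - P s)\<close>, and the
  second factor needs only the derivative of \<open>exp\<close> at 0.\<close>

lemma has_vector_derivative_exp_commuting:
  fixes P :: "real \<Rightarrow> 'a::{real_normed_algebra_1,banach}"
  assumes P: "(P has_vector_derivative P') (at s within S)"
    and "s \<in> S"
    and comm: "\<And>t. t \<in> S \<Longrightarrow> P s * P t = P t * P s"
  shows "((\<lambda>t. exp (P t)) has_vector_derivative exp (P s) * P') (at s within S)"
proof -
  have "((\<lambda>t. P t - P s) has_derivative (\<lambda>x. x *\<^sub>R P')) (at s within S)"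
    using has_derivative_diff[OF P[unfolded has_vector_derivative_def] has_derivative_const[of "P s"]]
    by simp
  then have "((\<lambda>t. exp (P t - P s)) has_derivative (\<lambda>x. x *\<^sub>R P')) (at s within S)"
    by (rule has_derivative_compose[where g = exp and g' = "\<lambda>h. h"])
      (simp add: exp_has_derivative_at_0)
  then have "((\<lambda>t. exp (P s) * exp (P t - P s)) has_vector_derivative exp (P s) * P') (at s within S)"
    unfolding has_vector_derivative_def
    by (drule_tac has_derivative_mult_right[where x = "exp (P s)"]) simp
  then show ?thesis
  proof (rule has_vector_derivative_transform[OF \<open>s \<in> S\<close>, rotated])
    fix t assume "t \<in> S"
    have "P s * (P t - P s) = (P t - P s) * P s"
      using comm[OF \<open>t \<in> S\<close>] by (simp add: algebra_simps)
    from exp_add_commuting[OF this] show "exp (P t) = exp (P s) * exp (P t - P s)" by simp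
  qed
qed

lemma commutes_with_inverse:
  fixes x m f :: "'a::monoid_mult"
  assumes "f * m = 1" "m * f = 1" "x * m = m * x"
  shows "x * f = f * x"
  by (metis assms mult.assoc mult_1_left mult_1_right)

text \<open>Since \<open>f t\<close> inverts \<open>M a t\<close>, the integrand
  \<open>N * f t\<close> is the logarithmic derivative of \<open>M a\<close>. Hence
  \<open>exp (- Z t) * M a t\<close> has derivative 0, where \<open>Z t\<close> is the integral from
  \<open>a\<close> to \<open>t\<close>, and its value at \<open>a\<close> is 1.\<close>

lemma exp_integral_eq:
  fixes N :: "'a::{real_normed_algebra_1,banach}"
  defines "M \<equiv> \<lambda>a t. 1 + (t - a) *\<^sub>R N"
  assumes ab: "a \<le> b"
    and cont: "continuous_on {a..b} f"
    and inv: "\<And>t. t \<in> {a..b} \<Longrightarrow> f t * M a t = 1 \<and> M a t * f t = 1"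
  shows "exp (integral {a..b} (\<lambda>t. N * f t)) = M a b"
proof -
  define g where "g t = N * f t" for t
  define Z where "Z s = integral {a..s} g" for s
  have contg: "continuous_on {a..b} g"
    unfolding g_def by (intro continuous_intros cont)
  have commf: "x * f t = f t * x" if "t \<in> {a..b}" "x * N = N * x" for x t
    using inv[OF that(1)] by (intro commutes_with_inverse[of "f t" "M a t"])
      (simp_all add: M_def algebra_simps that(2))
  have commg: "x * g t = g t * x" if "t \<in> {a..b}" "x * N = N * x" for x t
    unfolding g_def using commf[OF that] that(2) by (metis mult.assoc)
  \<comment> \<open>Kept general in \<open>x\<close>, because commutation is lifted in stages: from
    \<open>N\<close> to \<open>g\<close>, from \<open>g\<close> to \<open>Z\<close>, and then from
    \<open>g\<close> and \<open>Z\<close> to \<open>Z\<close> and \<open>Z\<close>, as the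
    derivative of \<open>exp (- Z t)\<close> requires.\<close>
  have commZ: "x * Z s = Z s * x" if "s \<in> {a..b}" "\<And>t. t \<in> {a..b} \<Longrightarrow> x * g t = g t * x" for x s
  proof -
    have int: "g integrable_on {a..s}"
      by (intro integrable_continuous_real continuous_on_subset[OF contg]) (use that in auto)
    have "x * Z s = integral {a..s} (\<lambda>t. x * g t)"
      using integral_linear[OF int bounded_linear_mult_right[of x]] by (simp add: Z_def o_def)
    also have "\<dots> = integral {a..s} (\<lambda>t. g t * x)"
      by (rule integral_cong) (use that in auto)
    also have "\<dots> = Z s * x"
      using integral_linear[OF int bounded_linear_mult_left[of x]] by (simp add: Z_def o_def)
    finally show ?thesis .
  qed
  have Ng: "N * g t = g t * N" if "t \<in> {a..b}" for t
    using commg[OF that, of N] by simp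
  have gg: "g s * g t = g t * g s" if "s \<in> {a..b}" "t \<in> {a..b}" for s t
    using commg[OF that(2)] Ng[OF that(1)] by simp
  have gZ: "g s * Z t = Z t * g s" if "s \<in> {a..b}" "t \<in> {a..b}" for s t
    using commZ[OF that(2)] gg that by blast
  have ZZ: "Z s * Z t = Z t * Z s" if "s \<in> {a..b}" "t \<in> {a..b}" for s t
    using commZ[OF that(2), of "Z s"] gZ that by metis
  have NZ: "N * Z t = Z t * N" if "t \<in> {a..b}" for t
    using commZ[OF that] Ng by blast
  have dZ: "(Z has_vector_derivative g s) (at s within {a..b})" if "s \<in> {a..b}" for s
    unfolding Z_def by (rule integral_has_vector_derivative[OF contg that])
  have gM: "g s * M a s = N" if "s \<in> {a..b}" for s
    using inv[OF that] by (simp add: g_def mult.assoc)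
  have d0: "((\<lambda>t. exp (- Z t) * M a t) has_vector_derivative 0) (at s within {a..b})"
    if s: "s \<in> {a..b}" for s
  proof -
    have "((\<lambda>t. - Z t) has_vector_derivative - g s) (at s within {a..b})"
      using dZ[OF s] by (rule has_vector_derivative_minus)
    then have "((\<lambda>t. exp (- Z t)) has_vector_derivative exp (- Z s) * (- g s)) (at s within {a..b})"
      by (rule has_vector_derivative_exp_commuting[OF _ s]) (use ZZ[OF s] in simp)
    moreover have "(M a has_vector_derivative N) (at s within {a..b})"
      unfolding M_def has_vector_derivative_def by (auto intro!: derivative_eq_intros)
    ultimately have "((\<lambda>t. exp (- Z t) * M a t) has_vector_derivative
        exp (- Z s) * N + exp (- Z s) * (- g s) * M a s) (at s within {a..b})"
      by (rule has_vector_derivative_mult)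
    moreover have "exp (- Z s) * N + exp (- Z s) * (- g s) * M a s = 0"
      using gM[OF s] by (simp add: mult.assoc)
    ultimately show ?thesis by simp
  qed
  obtain c where c: "exp (- Z t) * M a t = c" if "t \<in> {a..b}" for t
    by (rule has_vector_derivative_zero_constant[OF convex_real_interval(5) d0]) auto
  have "exp (- Z b) * M a b = exp (- Z a) * M a a"
    using c[of a] c[of b] ab by simp
  then have "exp (- Z b) * M a b = 1"
    by (simp add: Z_def M_def)
  then have "exp (Z b) * exp (- Z b) * M a b = exp (Z b)"
    by (simp add: mult.assoc)
  then show ?thesis
    by (simp add: exp_minus_inverse Z_def g_def[abs_def])
qed

text \<open>The function (exp x - 1) / x, given by its power series so that it makes sense for every
  x, invertible or not. It is the abstract form of \<open>psi1\<close>.\<close>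

definition phi1 :: "'a::{real_normed_algebra_1,banach} \<Rightarrow> 'a" where
  "phi1 x = (\<Sum>k. x ^ k /\<^sub>R fact (k + 1))"

text \<open>The exponential series at \<open>r\<close> is a majorant, uniform over the ball of
  radius \<open>r\<close>; this gives summability as well as continuity of
  \<open>phi1\<close>.\<close>

lemma norm_phi1_term_le:
  fixes x :: "'a::real_normed_algebra_1"
  assumes "norm x \<le> r"
  shows "norm (x ^ k /\<^sub>R fact (k + 1)) \<le> r ^ k /\<^sub>R fact k"
proof -
  have "norm (x ^ k) \<le> r ^ k"
    using norm_power_ineq[of x k] power_mono[OF assms norm_ge_zero, of k] by linarith
  moreover have "inverse (fact (k + 1)) \<le> (inverse (fact k) :: real)"
    by (intro le_imp_inverse_le fact_mono) auto
  ultimately have "inverse (fact (k + 1)) * norm (x ^ k) \<le> inverse (fact k) * r ^ k"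
    by (intro mult_mono) auto
  then show ?thesis by (simp del: fact_Suc)
qed

lemma summable_phi1: "summable (\<lambda>k. x ^ k /\<^sub>R fact (k + 1))"
  for x :: "'a::{real_normed_algebra_1,banach}"
  by (rule summable_comparison_test'[OF summable_exp_generic[of "norm x"]])
    (rule norm_phi1_term_le, simp)

lemma mult_phi1: "x * phi1 x = exp x - 1"
  using suminf_mult[OF summable_phi1[of x], of x] exp_first_term[of x]
  by (simp add: phi1_def del: fact_Suc)

lemma phi1_0: "phi1 0 = 1"
proof -
  have "phi1 (0::'a) = (\<Sum>k. if k = 0 then 1 else 0)"
    unfolding phi1_def by (rule arg_cong[where f = suminf]) (auto simp: power_0_left)
  then show ?thesis using suminf_finite[of "{0::nat}" "\<lambda>k. if k = 0 then 1 else (0::'a)"] by simp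
qed

lemma phi1_commutes:
  fixes x y :: "'a::{real_normed_algebra_1,banach}"
  assumes "x * y = y * x"
  shows "phi1 x * y = y * phi1 x"
proof -
  have "phi1 x * y = (\<Sum>k. x ^ k /\<^sub>R fact (k + 1) * y)"
    unfolding phi1_def by (rule suminf_mult2[OF summable_phi1])
  also have "\<dots> = (\<Sum>k. y * (x ^ k /\<^sub>R fact (k + 1)))"
    by (simp add: power_commuting_commutes[OF assms])
  also have "\<dots> = y * phi1 x"
    unfolding phi1_def by (rule suminf_mult[OF summable_phi1])
  finally show ?thesis .
qed

lemma isCont_phi1: "isCont phi1 (x :: 'a::{real_normed_algebra_1,banach})"
proof -
  \<comment> \<open>The extra 1 puts \<open>x\<close> inside the open ball on which the series
    converges uniformly.\<close>
  let ?r = "norm x + 1"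
  have "uniform_limit (ball 0 ?r) (\<lambda>n y. \<Sum>k<n. y ^ k /\<^sub>R fact (k + 1)) (phi1 :: 'a \<Rightarrow> 'a) sequentially"
    unfolding phi1_def
    by (rule Weierstrass_m_test[OF _ summable_exp_generic[of ?r]])
      (rule norm_phi1_term_le, simp)
  then have "continuous_on (ball 0 ?r) (phi1 :: 'a \<Rightarrow> 'a)"
    by (rule uniform_limit_theorem[rotated])
      (auto intro!: always_eventually continuous_intros)
  then show ?thesis
    by (rule continuous_on_interior) simp
qed

subsection \<open>Complex square matrices as a Banach algebra\<close>

lemma matrix_add_rdistrib: "((A + B) ** C) = (A ** C) + (B ** C)"
  by (vector matrix_matrix_mult_def sum.distrib[symmetric] distrib_right)

lemma matrix_diff_ldistrib: "(A ** (B - C)) = (A ** B) - (A ** C)" for A :: "'a::ring_1 ^ 'n ^ 'm"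
  by (vector matrix_matrix_mult_def sum_subtractf[symmetric] right_diff_distrib)

lemma matrix_diff_rdistrib: "((A - B) ** C) = (A ** C) - (B ** C)" for A :: "'a::ring_1 ^ 'n ^ 'm"
  by (vector matrix_matrix_mult_def sum_subtractf[symmetric] left_diff_distrib)

lemma scaleR_matrix_vector_mult: "(a *\<^sub>R A) *v x = a *\<^sub>R (A *v x)"
  for A :: "'a::real_algebra_1 ^ 'n ^ 'm"
  by (simp add: matrix_vector_mult_def vec_eq_iff scaleR_sum_right)

text \<open>A copy of the matrix type with the matrix product as multiplication and the operator
  norm as norm. On \<open>complex ^ 'n ^ 'n\<close> itself the multiplication is componentwise and
  the norm is Euclidean, so the identity matrix is in general neither a unit nor of norm 1.\<close>

typedef 'n sqmat = "UNIV :: (complex ^ 'n::finite ^ 'n) set" ..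

setup_lifting type_definition_sqmat

instantiation sqmat :: (finite) real_algebra_1
begin

lift_definition zero_sqmat :: "'a sqmat" is 0 .
lift_definition one_sqmat :: "'a sqmat" is "mat 1" .
lift_definition plus_sqmat :: "'a sqmat \<Rightarrow> 'a sqmat \<Rightarrow> 'a sqmat" is "(+)" .
lift_definition minus_sqmat :: "'a sqmat \<Rightarrow> 'a sqmat \<Rightarrow> 'a sqmat" is "(-)" .
lift_definition uminus_sqmat :: "'a sqmat \<Rightarrow> 'a sqmat" is uminus .
lift_definition times_sqmat :: "'a sqmat \<Rightarrow> 'a sqmat \<Rightarrow> 'a sqmat" is "(**)" .
lift_definition scaleR_sqmat :: "real \<Rightarrow> 'a sqmat \<Rightarrow> 'a sqmat" is scaleR .

instance
proof
  fix X Y Z :: "'a sqmat" and a b :: real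
  show "X + Y + Z = X + (Y + Z)" "X + Y = Y + X" "0 + X = X" "- X + X = 0" "X - Y = X + - Y"
    "a *\<^sub>R (X + Y) = a *\<^sub>R X + a *\<^sub>R Y" "(a + b) *\<^sub>R X = a *\<^sub>R X + b *\<^sub>R X"
    "a *\<^sub>R b *\<^sub>R X = (a * b) *\<^sub>R X" "1 *\<^sub>R X = X"
    by (transfer; simp add: algebra_simps)+
  show "X * Y * Z = X * (Y * Z)" by transfer (simp add: matrix_mul_assoc)
  show "(X + Y) * Z = X * Z + Y * Z" by transfer (simp add: matrix_add_rdistrib)
  show "X * (Y + Z) = X * Y + X * Z" by transfer (simp add: matrix_add_ldistrib)
  show "a *\<^sub>R X * Y = a *\<^sub>R (X * Y)" by transfer (rule scalar_matrix_assoc[symmetric])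
  show "X * a *\<^sub>R Y = a *\<^sub>R (X * Y)" by transfer (simp add: matrix_scalar_ac scalar_matrix_assoc)
  show "1 * X = X" "X * 1 = X" by (transfer; simp)+
  show "(0::'a sqmat) \<noteq> 1" by transfer (simp add: mat_def vec_eq_iff)
qed

end

instantiation sqmat :: (finite) real_normed_algebra_1
begin

lift_definition norm_sqmat :: "'a sqmat \<Rightarrow> real" is "\<lambda>A. onorm ((*v) A)" .

definition dist_sqmat :: "'a sqmat \<Rightarrow> 'a sqmat \<Rightarrow> real" where
  "dist_sqmat X Y = norm (X - Y)"
definition sgn_sqmat :: "'a sqmat \<Rightarrow> 'a sqmat" where
  "sgn_sqmat X = X /\<^sub>R norm X"
definition uniformity_sqmat :: "('a sqmat \<times> 'a sqmat) filter" where
  "uniformity_sqmat = (INF e\<in>{0<..}. principal {(X, Y). dist X Y < e})"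
definition open_sqmat :: "'a sqmat set \<Rightarrow> bool" where
  "open_sqmat U \<longleftrightarrow> (\<forall>X\<in>U. eventually (\<lambda>(X', Y). X' = X \<longrightarrow> Y \<in> U) uniformity)"

instance
proof
  fix X Y :: "'a sqmat" and a :: real and U :: "'a sqmat set"
  show "dist X Y = norm (X - Y)" by (rule dist_sqmat_def)
  show "sgn X = X /\<^sub>R norm X" by (rule sgn_sqmat_def)
  show "uniformity = (INF e\<in>{0<..}. principal {(X, Y::'a sqmat). dist X Y < e})"
    by (rule uniformity_sqmat_def)
  show "open U \<longleftrightarrow> (\<forall>X\<in>U. \<forall>\<^sub>F (X', Y) in uniformity. X' = X \<longrightarrow> Y \<in> U)"
    by (rule open_sqmat_def)
  show "norm X = 0 \<longleftrightarrow> X = 0"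
    by transfer (simp add: onorm_eq_0 matrix_eq)
  show "norm (X + Y) \<le> norm X + norm Y"
  proof transfer
    fix A B :: "complex ^ 'a ^ 'a"
    show "onorm ((*v) (A + B)) \<le> onorm ((*v) A) + onorm ((*v) B)"
      using onorm_triangle[of "(*v) A" "(*v) B"] by (simp add: matrix_vector_mult_add_rdistrib[abs_def])
  qed
  show "norm (a *\<^sub>R X) = \<bar>a\<bar> * norm X"
  proof transfer
    fix a and A :: "complex ^ 'a ^ 'a"
    show "onorm ((*v) (a *\<^sub>R A)) = \<bar>a\<bar> * onorm ((*v) A)"
      using onorm_scaleR[of "(*v) A" a] by (simp add: scaleR_matrix_vector_mult[abs_def])
  qed
  show "norm (X * Y) \<le> norm X * norm Y"
  proof transfer
    fix A B :: "complex ^ 'a ^ 'a"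
    show "onorm ((*v) (A ** B)) \<le> onorm ((*v) A) * onorm ((*v) B)"
      using onorm_compose[of "(*v) A" "(*v) B"] by (simp add: o_def matrix_vector_mul_assoc)
  qed
  show "norm (1::'a sqmat) = 1"
    by transfer (simp add: matrix_vector_mul_lid[abs_def] onorm_id)
qed

end

lemma matrix_vector_mul_axis_nth: "(A *v axis j 1) $ i = A $ i $ j" for A :: "'a::semiring_1 ^ 'n ^ 'm"
  by (simp add: matrix_vector_mult_def axis_def if_distrib cong: if_cong)

text \<open>An entry is a coordinate of the image of a unit vector, hence bounded by the operator
  norm; summing over all entries bounds the Euclidean norm. This makes the passage from
  \<open>sqmat\<close> back to matrices continuous.\<close>

lemma norm_le_onorm_matrix:
  fixes A :: "complex ^ 'n ^ 'n"
  shows "norm A \<le> real CARD('n) * (real CARD('n) * onorm ((*v) A))"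
proof -
  have comp: "norm (A $ i $ j) \<le> onorm ((*v) A)" for i j
  proof -
    have "norm (A $ i $ j) \<le> norm (A *v axis j 1)"
      using Finite_Cartesian_Product.norm_nth_le[of "A *v axis j 1" i] by (simp add: matrix_vector_mul_axis_nth)
    also have "\<dots> \<le> onorm ((*v) A)"
      using onorm[of "(*v) A" "axis j 1"] by (simp add: norm_axis_1)
    finally show ?thesis .
  qed
  have vec: "norm v \<le> (\<Sum>i\<in>UNIV. norm (v $ i))" for v :: "'b::real_normed_vector ^ 'n"
    by (simp add: norm_vec_def L2_set_le_sum)
  have "norm A \<le> (\<Sum>i\<in>UNIV. \<Sum>j\<in>UNIV. norm (A $ i $ j))"
    by (rule order_trans[OF vec]) (intro sum_mono vec)
  also have "\<dots> \<le> (\<Sum>i\<in>(UNIV::'n set). \<Sum>j\<in>(UNIV::'n set). onorm ((*v) A))"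
    by (intro sum_mono comp)
  finally show ?thesis by simp
qed

lemma bounded_linear_Rep_sqmat: "bounded_linear (Rep_sqmat :: 'n::finite sqmat \<Rightarrow> _)"
proof (rule bounded_linear_intro)
  fix X :: "'n sqmat"
  show "norm (Rep_sqmat X) \<le> norm X * (real CARD('n) * real CARD('n))"
    using norm_le_onorm_matrix[of "Rep_sqmat X"] by (simp add: norm_sqmat.rep_eq ac_simps)
qed (simp_all add: plus_sqmat.rep_eq scaleR_sqmat.rep_eq)

lemma bounded_linear_Abs_sqmat: "bounded_linear (Abs_sqmat :: complex ^ 'n ^ 'n \<Rightarrow> _)"
  by (rule linear_conv_bounded_linear[THEN iffD1], rule linearI)
    (simp_all add: plus_sqmat.abs_eq scaleR_sqmat.abs_eq eq_onp_def)

instance sqmat :: (finite) banach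
proof
  fix X :: "nat \<Rightarrow> 'a sqmat"
  assume "Cauchy X"
  then have "Cauchy (\<lambda>n. Rep_sqmat (X n))"
    by (rule bounded_linear.Cauchy[OF bounded_linear_Rep_sqmat])
  then obtain A where "(\<lambda>n. Rep_sqmat (X n)) \<longlonglongrightarrow> A"
    using Cauchy_convergent convergent_def by blast
  then have "(\<lambda>n. Abs_sqmat (Rep_sqmat (X n))) \<longlonglongrightarrow> Abs_sqmat A"
    by (rule bounded_linear.tendsto[OF bounded_linear_Abs_sqmat])
  then show "convergent X"
    unfolding convergent_def by (auto simp: Rep_sqmat_inverse)
qed

lemmas [simp] = Abs_sqmat_inverse[OF UNIV_I] Rep_sqmat_inverse

section \<open>Matrix exponential and \<open>psi1\<close> through the Banach algebra\<close>

lemma Rep_Abs_sqmat_power: "Rep_sqmat (Abs_sqmat X ^ k) = matpow X k"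
  by (induction k) (simp_all add: one_sqmat.rep_eq times_sqmat.rep_eq)

lemma mexp_conv_exp: "mexp X = Rep_sqmat (exp (Abs_sqmat X))"
  using bounded_linear.suminf[OF bounded_linear_Rep_sqmat summable_exp_generic[of "Abs_sqmat X"]]
  by (simp add: mexp_def exp_def scaleR_sqmat.rep_eq Rep_Abs_sqmat_power divide_inverse)

lemma psi1_conv_phi1: "psi1 X = Rep_sqmat (phi1 (Abs_sqmat X))"
  using bounded_linear.suminf[OF bounded_linear_Rep_sqmat summable_phi1[of "Abs_sqmat X"]]
  by (simp add: psi1_def phi1_def scaleR_sqmat.rep_eq Rep_Abs_sqmat_power divide_inverse del: fact_Suc)

lemma Abs_sqmat_mult: "Abs_sqmat X * Abs_sqmat Y = Abs_sqmat (X ** Y)"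
  by (simp add: times_sqmat.abs_eq eq_onp_def)

lemma sqmat_eq_iff: "X = Y \<longleftrightarrow> Rep_sqmat X = Rep_sqmat Y"
  by (simp add: Rep_sqmat_inject)

lemma mult_psi1: "X ** psi1 X = mexp X - mat 1"
  using arg_cong[OF mult_phi1[of "Abs_sqmat X"], of Rep_sqmat]
  by (simp add: psi1_conv_phi1 mexp_conv_exp times_sqmat.rep_eq minus_sqmat.rep_eq one_sqmat.rep_eq)

lemma psi1_commutes:
  assumes "X ** Y = Y ** X"
  shows "psi1 X ** Y = Y ** psi1 X"
  using arg_cong[OF phi1_commutes[of "Abs_sqmat X" "Abs_sqmat Y"], of Rep_sqmat] assms
  by (simp add: psi1_conv_phi1 times_sqmat.rep_eq Abs_sqmat_mult)

lemma isCont_psi1: "isCont psi1 X"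
proof -
  have "isCont (\<lambda>X. phi1 (Abs_sqmat X)) X"
    by (rule isCont_o2[OF bounded_linear.isCont[OF bounded_linear_Abs_sqmat continuous_ident] isCont_phi1])
  from bounded_linear.isCont[OF bounded_linear_Rep_sqmat this]
  show ?thesis by (simp add: psi1_conv_phi1[abs_def])
qed

text \<open>Writing \<open>mexp X\<close> as \<open>X ** psi1 X + mat 1\<close> reduces the claim to
  the commutation already known for \<open>psi1\<close>.\<close>

lemma mexp_commutes:
  assumes "X ** Y = Y ** X"
  shows "mexp X ** Y = Y ** mexp X"
proof -
  have "(X ** psi1 X + mat 1) ** Y = Y ** (X ** psi1 X + mat 1)"
    using psi1_commutes[OF assms] assms
    by (simp add: matrix_add_ldistrib matrix_add_rdistrib) (metis matrix_mul_assoc)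
  then show ?thesis by (simp add: mult_psi1)
qed

text \<open>The addition theorem for commuting exponents, in the form suited to comparing two
  logarithms of the same matrix.\<close>

lemma mexp_diff:
  assumes "X ** Y = Y ** X"
  shows "mexp (X - Y) ** mexp Y = mexp X"
proof -
  have "Abs_sqmat (X - Y) * Abs_sqmat Y = Abs_sqmat Y * Abs_sqmat (X - Y)"
    using assms by (simp add: Abs_sqmat_mult matrix_diff_ldistrib matrix_diff_rdistrib)
  from exp_add_commuting[OF this] show ?thesis
    by (simp add: mexp_conv_exp flip: times_sqmat.rep_eq)
      (simp add: plus_sqmat.abs_eq eq_onp_def)
qed

lemma invertible_mexp: "invertible (mexp X)"
proof -
  have 1: "exp Z * exp (- Z) = 1" for Z :: "'a sqmat" by (rule exp_minus_inverse)
  show ?thesis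
    unfolding invertible_def mexp_conv_exp
    using 1[of "Abs_sqmat X"] 1[of "- Abs_sqmat X"]
    by (metis (no_types) minus_minus one_sqmat.rep_eq times_sqmat.rep_eq)
qed

subsection \<open>Eigenvectors in invariant subspaces\<close>

text \<open>This is p(Y) v by Horner's scheme, carried out on vectors so that the matrix p(Y) is
  never formed.\<close>

definition poly_mat_vec :: "'a::field poly \<Rightarrow> 'a ^ 'n::finite ^ 'n \<Rightarrow> 'a ^ 'n \<Rightarrow> 'a ^ 'n" where
  "poly_mat_vec p Y v = fold_coeffs (\<lambda>a r. a *s v + Y *v r) p 0"

lemma poly_mat_vec_0 [simp]: "poly_mat_vec 0 Y v = 0"
  by (simp add: poly_mat_vec_def)

lemma poly_mat_vec_pCons [simp]: "poly_mat_vec (pCons a p) Y v = a *s v + Y *v poly_mat_vec p Y v"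
  by (cases "p = 0 \<and> a = 0") (auto simp: poly_mat_vec_def)

lemma poly_mat_vec_add: "poly_mat_vec (p + q) Y v = poly_mat_vec p Y v + poly_mat_vec q Y v"
  by (induction p q rule: poly_induct2)
    (simp_all add: matrix_vector_right_distrib vec.scale_left_distrib)

lemma poly_mat_vec_smult: "poly_mat_vec (smult c p) Y v = c *s poly_mat_vec p Y v"
  by (induction p) (simp_all add: vec.scale_right_distrib vec.scale)

lemma poly_mat_vec_sum: "poly_mat_vec (sum f I) Y v = (\<Sum>i\<in>I. poly_mat_vec (f i) Y v)"
  by (induction I rule: infinite_finite_induct) (simp_all add: poly_mat_vec_add)

lemma poly_mat_vec_monom: "poly_mat_vec (monom c k) Y v = c *s (((*v) Y ^^ k) v)"
  by (induction k) (simp_all add: monom_0 monom_Suc vec.scale)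

lemma poly_mat_vec_in_subspace:
  assumes "vec.subspace S" "\<And>x. x \<in> S \<Longrightarrow> Y *v x \<in> S" "v \<in> S"
  shows "poly_mat_vec p Y v \<in> S"
  by (induction p) (simp_all add: assms vec.subspace_0 vec.subspace_add vec.subspace_scale)

text \<open>The n + 1 vectors v, Y v, ..., Y^n v are linearly dependent in dimension n. Dependence
  is a notion about sets of vectors, so a repetition in the list is treated apart: there the
  difference of two monomials annihilates v.\<close>

lemma annihilating_poly_exists:
  fixes Y :: "'a::field ^ 'n ^ 'n"
  shows "\<exists>p. p \<noteq> 0 \<and> poly_mat_vec p Y v = 0"
proof (cases "inj_on (\<lambda>k. ((*v) Y ^^ k) v) {..CARD('n)}")
  case False
  then obtain i j where ij: "i \<noteq> j" "((*v) Y ^^ i) v = ((*v) Y ^^ j) v"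
    by (auto simp: inj_on_def)
  have "coeff (monom 1 i + smult (-1) (monom 1 j)) i \<noteq> (0::'a)"
    using ij by simp
  then have "monom 1 i + smult (-1) (monom 1 j) \<noteq> (0::'a poly)"
    by (metis coeff_0)
  moreover have "poly_mat_vec (monom 1 i + smult (-1) (monom 1 j)) Y v = 0"
    unfolding poly_mat_vec_add poly_mat_vec_smult poly_mat_vec_monom ij(2) by simp
  ultimately show ?thesis by blast
next
  case inj: True
  let ?x = "\<lambda>k. ((*v) Y ^^ k) v"
  have "vec.dim (?x ` {..CARD('n)}) \<le> CARD('n)"
    using vec.dim_subset[OF subset_UNIV] by (metis vec_dim_card)
  then have "vec.dependent (?x ` {..CARD('n)})"
    by (intro vec.dependent_biggerset_general) (simp add: card_image[OF inj])
  then obtain u k where k: "k \<le> CARD('n)" "u (?x k) \<noteq> 0"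
    and sum: "(\<Sum>w\<in>?x ` {..CARD('n)}. u w *s w) = 0"
    by (auto simp: vec.dependent_finite)
  define p where "p = (\<Sum>i\<le>CARD('n). monom (u (?x i)) i)"
  have "coeff p k = u (?x k)"
    using k(1) by (simp add: p_def coeff_sum sum.delta)
  then have "p \<noteq> 0" using k(2) by auto
  moreover have "poly_mat_vec p Y v = 0"
    using sum by (simp add: p_def poly_mat_vec_sum poly_mat_vec_monom sum.reindex[OF inj] o_def)
  ultimately show ?thesis by blast
qed

text \<open>Split a root z off an annihilating polynomial of v, p = (X - z) q. Either q(Y) v = 0 and
  the degree has dropped, or q(Y) v is an eigenvector for z, and it lies in the invariant subspace
  because v does.\<close>

lemma invariant_subspace_eigenvector:
  fixes Y :: "complex ^ 'n ^ 'n"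
  assumes S: "vec.subspace S" "\<And>x. x \<in> S \<Longrightarrow> Y *v x \<in> S"
    and v: "v \<in> S" "v \<noteq> 0"
  obtains w z where "w \<in> S" "w \<noteq> 0" "Y *v w = z *s w"
proof -
  obtain p where "p \<noteq> 0" "poly_mat_vec p Y v = 0"
    using annihilating_poly_exists by blast
  then have "\<exists>w z. w \<in> S \<and> w \<noteq> 0 \<and> Y *v w = z *s w"
  proof (induction "degree p" arbitrary: p rule: less_induct)
    case less
    show ?case
    proof (cases "degree p = 0")
      case True
      then obtain c where "p = [:c:]" using degree_eq_zeroE by blast
      with less.prems v show ?thesis by simp
    next
      case False
      then obtain z where "poly p z = 0"
        using fundamental_theorem_of_algebra constant_degree by metis
      then obtain q where q: "p = [:-z, 1:] * q"
        by (metis dvdE poly_eq_0_iff_dvd)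
      with less.prems have "q \<noteq> 0" by auto
      have pq: "poly_mat_vec p Y v = Y *v poly_mat_vec q Y v - z *s poly_mat_vec q Y v"
        using poly_mat_vec_add[of "pCons 0 q" "smult (-z) q" Y v] poly_mat_vec_smult[of "-z" q Y v]
        by (simp add: q)
      show ?thesis
      proof (cases "poly_mat_vec q Y v = 0")
        case True
        have "degree q < degree p"
          using \<open>q \<noteq> 0\<close> by (simp add: q degree_mult_eq del: mult_pCons_left)
        then show ?thesis using less.hyps \<open>q \<noteq> 0\<close> True by blast
      next
        case nz: False
        have "Y *v poly_mat_vec q Y v = z *s poly_mat_vec q Y v"
          using pq less.prems(2) by simp
        then show ?thesis
          using nz poly_mat_vec_in_subspace[OF S v(1)] by blast
      qed
    qed
  qed
  then show ?thesis using that by blast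
qed

lemma not_invertible_iff_ker:
  fixes M :: "'a::field ^ 'n ^ 'n"
  shows "\<not> invertible M \<longleftrightarrow> (\<exists>v. v \<noteq> 0 \<and> M *v v = 0)"
  using matrix_left_invertible_ker[of M] by (auto simp: invertible_left_inverse)

lemma csm_mult_vec: "csm c M *v v = c *s (M *v v)"
  by (simp add: csm_def matrix_vector_mult_def vec_eq_iff sum_distrib_left mult.assoc)

lemma is_eigenvalue_iff: "is_eigenvalue Y z \<longleftrightarrow> (\<exists>v. v \<noteq> 0 \<and> Y *v v = z *s v)"
  unfolding is_eigenvalue_def
  using not_invertible_iff_ker[of "Y - csm z (mat 1)"]
  by (simp add: invertible_det_nz matrix_vector_mult_diff_rdistrib csm_mult_vec)

section \<open>Continuity of matrix products, and \<open>psi1\<close> on eigenvectors\<close>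

lemma bounded_bilinear_matrix_mult:
  "bounded_bilinear ((**) :: complex ^ 'n ^ 'm \<Rightarrow> complex ^ 'k ^ 'n \<Rightarrow> complex ^ 'k ^ 'm)"
  by (intro bilinear_conv_bounded_bilinear[THEN iffD1])
    (auto simp: bilinear_def linear_iff matrix_add_ldistrib matrix_add_rdistrib matrix_scalar_ac
      scalar_matrix_assoc)

lemmas continuous_on_matrix_mult [continuous_intros] =
  bounded_bilinear.continuous_on[OF bounded_bilinear_matrix_mult]
lemmas tendsto_matrix_mult [tendsto_intros] =
  bounded_bilinear.tendsto[OF bounded_bilinear_matrix_mult]
lemmas bounded_linear_matrix_mult_left = bounded_bilinear.bounded_linear_left[OF bounded_bilinear_matrix_mult]
lemmas bounded_linear_matrix_mult_right = bounded_bilinear.bounded_linear_right[OF bounded_bilinear_matrix_mult]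

lemma bounded_linear_matrix_vector: "bounded_linear (\<lambda>X. X *v v)" for v :: "complex ^ 'n"
  by (intro linear_conv_bounded_linear[THEN iffD1] linearI)
    (simp_all add: matrix_vector_mult_add_rdistrib scaleR_matrix_vector_mult)

lemma bounded_linear_vector_scale: "bounded_linear (\<lambda>c. c *s v)" for v :: "complex ^ 'n"
  by (intro linear_conv_bounded_linear[THEN iffD1] linearI) (simp_all add: vec_eq_iff algebra_simps)

lemma matpow_eigenvector:
  assumes "Y *v v = y *s v"
  shows "matpow Y k *v v = y ^ k *s v"
  by (induction k) (simp_all add: assms vec.scale mult.commute flip: matrix_vector_mul_assoc)

lemma psi1_eigenvector:
  assumes "Y *v v = y *s v"
  shows "psi1 Y *v v = phi1 y *s v"
proof -
  have "(\<lambda>k. (1 / fact (k + 1)) *\<^sub>R matpow Y k) sums psi1 Y"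
    using bounded_linear.sums[OF bounded_linear_Rep_sqmat summable_sums[OF summable_phi1[of "Abs_sqmat Y"]]]
    by (simp add: psi1_conv_phi1 phi1_def scaleR_sqmat.rep_eq Rep_Abs_sqmat_power inverse_eq_divide del: fact_Suc)
  moreover have term_eq: "((1 / fact (k + 1)) *\<^sub>R matpow Y k) *v v = (y ^ k /\<^sub>R fact (k + 1)) *s v" for k
    by (simp add: scaleR_matrix_vector_mult matpow_eigenvector[OF assms] divide_inverse vec_eq_iff
        del: fact_Suc)
  ultimately have "(\<lambda>k. (y ^ k /\<^sub>R fact (k + 1)) *s v) sums (psi1 Y *v v)"
    using bounded_linear.sums[OF bounded_linear_matrix_vector] by (simp only: term_eq[symmetric])
  moreover have "(\<lambda>k. (y ^ k /\<^sub>R fact (k + 1)) *s v) sums (phi1 y *s v)"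
    unfolding phi1_def by (rule bounded_linear.sums[OF bounded_linear_vector_scale summable_sums[OF summable_phi1]])
  ultimately show ?thesis by (rule sums_unique2)
qed

text \<open>A zero of (exp z - 1) / z is a multiple of 2 pi \<i>, and the bound on the imaginary
  part leaves only z = 0, where the value is 1.\<close>

lemma phi1_eq_0_imp:
  assumes "phi1 (z::complex) = 0" "\<bar>Im z\<bar> < 2 * pi"
  shows False
proof -
  have "exp z = exp 0" using mult_phi1[of z] assms(1) by simp
  then obtain n :: int where n: "z = 0 + of_int (2 * n) * pi * \<i>"
    unfolding exp_eq by blast
  then have "\<bar>of_int n * pi\<bar> < pi" using assms(2) by simp
  then have "n = 0" by (simp add: abs_mult)
  then show False using n assms(1) by (simp add: phi1_0)
qed

subsection \<open>The principal logarithm\<close>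

abbreviation principal_strip :: "complex ^ 'n ^ 'n \<Rightarrow> bool" where
  "principal_strip Y \<equiv> \<forall>z. is_eigenvalue Y z \<longrightarrow> - pi < Im z \<and> Im z < pi"

text \<open>A nontrivial kernel of \<open>psi1 (X - Y)\<close> is invariant under \<open>X\<close>,
  and an eigenspace of \<open>X\<close> inside it is invariant under \<open>Y\<close>; so it
  contains a common eigenvector. On that vector the matrix acts as \<open>phi1 (x - y)\<close>, with
  \<open>x - y\<close> of imaginary part below 2 pi in modulus.\<close>

lemma invertible_psi1_diff:
  assumes comm: "X ** Y = Y ** X"
    and X: "principal_strip X" and Y: "principal_strip Y"
  shows "invertible (psi1 (X - Y))"
proof (rule ccontr)
  assume "\<not> ?thesis"
  then obtain v where v: "v \<noteq> 0" "psi1 (X - Y) *v v = 0"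
    using not_invertible_iff_ker by blast
  let ?P = "psi1 (X - Y)"
  have PX: "?P ** X = X ** ?P" and PY: "?P ** Y = Y ** ?P"
    using comm by (auto intro!: psi1_commutes simp: matrix_diff_ldistrib matrix_diff_rdistrib)
  let ?S = "{u. ?P *v u = 0}"
  have "vec.subspace ?S"
    by (auto simp: vec.subspace_def matrix_vector_right_distrib vec.scale)
  moreover have "X *v u \<in> ?S" if "u \<in> ?S" for u
    using that PX by (metis (mono_tags) matrix_vector_mul_assoc matrix_vector_mult_0_right mem_Collect_eq)
  ultimately obtain w x where w: "w \<in> ?S" "w \<noteq> 0" "X *v w = x *s w"
    using invariant_subspace_eigenvector[of ?S X v] v by blast
  let ?T = "{u. ?P *v u = 0 \<and> X *v u = x *s u}"
  have "vec.subspace ?T"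
    by (auto simp: vec.subspace_def matrix_vector_right_distrib vec.scale vec.scale_right_distrib mult.commute)
  moreover have "Y *v u \<in> ?T" if "u \<in> ?T" for u
  proof -
    have "?P *v (Y *v u) = 0"
      using that PY by (metis (mono_tags) matrix_vector_mul_assoc matrix_vector_mult_0_right mem_Collect_eq)
    moreover have "X *v (Y *v u) = x *s (Y *v u)"
      using that comm by (metis (mono_tags) matrix_vector_mul_assoc vec.scale mem_Collect_eq)
    ultimately show ?thesis by simp
  qed
  ultimately obtain u y where u: "u \<in> ?T" "u \<noteq> 0" "Y *v u = y *s u"
    using invariant_subspace_eigenvector[of ?T Y w] w by blast
  have "(X - Y) *v u = (x - y) *s u"
    using u by (simp add: matrix_vector_mult_diff_rdistrib vec.scale_left_diff_distrib)
  then have "phi1 (x - y) *s u = 0"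
    using psi1_eigenvector u by fastforce
  then have "phi1 (x - y) = 0" using u(2) by simp
  moreover have "\<bar>Im x\<bar> < pi" "\<bar>Im y\<bar> < pi"
    using X Y u by (fastforce simp: is_eigenvalue_iff)+
  ultimately show False using phi1_eq_0_imp[of "x - y"] by simp linarith
qed

text \<open>Comparison with the zero matrix, whose only eigenvalue 0 lies in the strip.\<close>

lemma invertible_psi1:
  assumes "principal_strip Y"
  shows "invertible (psi1 Y)"
proof -
  have "principal_strip (0 :: complex ^ 'a ^ 'a)" by (auto simp: is_eigenvalue_iff)
  then show ?thesis using invertible_psi1_diff[of Y 0] assms by simp
qed

text \<open>Dividing the equal exponentials gives \<open>mexp (X - Y) = mat 1\<close>, that is
  \<open>(X - Y) ** psi1 (X - Y) = 0\<close>, and the second factor can be cancelled.\<close>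

lemma mexp_inject:
  assumes comm: "X ** Y = Y ** X"
    and strip: "principal_strip X" "principal_strip Y"
    and eq: "mexp X = mexp Y"
  shows "X = Y"
proof -
  obtain B where "mexp Y ** B = mat 1"
    using invertible_mexp[of Y] by (auto simp: invertible_def)
  moreover have "mexp (X - Y) ** mexp Y ** B = mexp Y ** B"
    using mexp_diff[OF comm] eq by simp
  ultimately have "mexp (X - Y) = mat 1"
    by (simp flip: matrix_mul_assoc)
  then have 0: "(X - Y) ** psi1 (X - Y) = 0"
    by (simp add: mult_psi1)
  obtain C where "psi1 (X - Y) ** C = mat 1"
    using invertible_psi1_diff[OF comm strip] by (auto simp: invertible_def)
  moreover have "(X - Y) ** psi1 (X - Y) ** C = 0"
    by (simp add: 0)
  ultimately have "X - Y = 0"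
    by (simp flip: matrix_mul_assoc)
  then show ?thesis by simp
qed

text \<open>A competing logarithm commutes with its own exponential \<open>M\<close>, hence with
  \<open>Z\<close> by \<open>comm\<close>, so injectivity on commuting pairs settles uniqueness. For
  the integrals below \<open>comm\<close> is available because the integrand is a rational function
  of \<open>M\<close>.\<close>

lemma mlog_eqI:
  assumes "mexp Z = M" "principal_strip Z"
    and comm: "\<And>Y. Y ** M = M ** Y \<Longrightarrow> Y ** Z = Z ** Y"
  shows "mlog M = Z"
  unfolding mlog_def
proof (rule the_equality)
  show "mexp Z = M \<and> principal_strip Z" using assms by simp
next
  fix Y assume Y: "mexp Y = M \<and> principal_strip Y"
  then have "Y ** M = M ** Y" using mexp_commutes[of Y Y] by simp
  show "Y = Z"
  proof (rule mexp_inject)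
    show "Y ** Z = Z ** Y" by (rule comm) fact
    show "principal_strip Y" "mexp Y = mexp Z" using Y \<open>mexp Z = M\<close> by simp_all
  qed fact
qed

lemma mexp_integral:
  fixes N :: "complex ^ 'n ^ 'n"
  assumes "a \<le> b" and cont: "continuous_on {a..b} f"
    and inv: "\<And>t. t \<in> {a..b} \<Longrightarrow>
      f t ** (mat 1 + (t - a) *\<^sub>R N) = mat 1 \<and> (mat 1 + (t - a) *\<^sub>R N) ** f t = mat 1"
  shows "mexp (integral {a..b} (\<lambda>t. N ** f t)) = mat 1 + (b - a) *\<^sub>R N"
proof -
  have int: "(\<lambda>t. N ** f t) integrable_on {a..b}"
    by (intro integrable_continuous_real continuous_intros cont)
  have M: "Rep_sqmat (1 + t *\<^sub>R Abs_sqmat N) = mat 1 + t *\<^sub>R N" for t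
    by (simp add: plus_sqmat.rep_eq one_sqmat.rep_eq scaleR_sqmat.rep_eq)
  have "exp (integral {a..b} (\<lambda>t. Abs_sqmat N * Abs_sqmat (f t))) = 1 + (b - a) *\<^sub>R Abs_sqmat N"
  proof (rule exp_integral_eq[OF \<open>a \<le> b\<close>])
    show "continuous_on {a..b} (\<lambda>t. Abs_sqmat (f t))"
      by (rule bounded_linear.continuous_on[OF bounded_linear_Abs_sqmat cont])
    show "Abs_sqmat (f t) * (1 + (t - a) *\<^sub>R Abs_sqmat N) = 1 \<and>
        (1 + (t - a) *\<^sub>R Abs_sqmat N) * Abs_sqmat (f t) = 1" if "t \<in> {a..b}" for t
      using inv[OF that] by (simp add: sqmat_eq_iff times_sqmat.rep_eq M one_sqmat.rep_eq)
  qed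
  moreover have "integral {a..b} (\<lambda>t. Abs_sqmat N * Abs_sqmat (f t)) =
      Abs_sqmat (integral {a..b} (\<lambda>t. N ** f t))"
    using integral_linear[OF int bounded_linear_Abs_sqmat] by (simp add: o_def Abs_sqmat_mult)
  ultimately show ?thesis by (simp add: mexp_conv_exp M)
qed

text \<open>A segment that starts at 1 and avoids 0 cannot reach the nonpositive real axis, so
  \<open>Ln\<close> is differentiable along it and provides an antiderivative.\<close>

lemma integral_Ln_line:
  fixes z :: complex
  assumes "a \<le> b" and nz: "\<And>t. t \<in> {a..b} \<Longrightarrow> 1 + of_real (t - a) * z \<noteq> 0"
  shows "1 + of_real (b - a) * z \<notin> \<real>\<^sub>\<le>\<^sub>0"
    and "((\<lambda>t. z / (1 + of_real (t - a) * z)) has_integral Ln (1 + of_real (b - a) * z)) {a..b}"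
proof -
  have slit: "1 + of_real (t - a) * z \<notin> \<real>\<^sub>\<le>\<^sub>0" if t: "t \<in> {a..b}" for t
  proof
    assume "1 + of_real (t - a) * z \<in> \<real>\<^sub>\<le>\<^sub>0"
    then obtain r where r: "r \<le> 0" "1 + of_real (t - a) * z = of_real r"
      by (auto elim: nonpos_Reals_cases)
    \<comment> \<open>The straight path from 1 to \<open>r\<close> passes through 0 after the
      fraction \<open>1 / (1 - r)\<close> of its length; \<open>?s\<close> is the parameter of that
      point.\<close>
    let ?s = "a + (t - a) / (1 - r)"
    have "(t - a) / (1 - r) \<le> t - a"
      using t r(1) divide_left_mono[of 1 "1 - r" "t - a"] by simp
    then have "?s \<in> {a..b}" using t r(1) by simp
    moreover have "1 + of_real (?s - a) * z = 0"
    proof -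
      have "of_real (t - a) * z = of_real (r - 1)" using r(2) by (simp add: algebra_simps)
      then have "of_real (?s - a) * z = of_real (r - 1) / of_real (1 - r)" by simp
      also have "\<dots> = -1" using r(1) by (simp flip: of_real_divide add: divide_eq_eq)
      finally show ?thesis by simp
    qed
    ultimately show False using nz by blast
  qed
  from slit[of b] show "1 + of_real (b - a) * z \<notin> \<real>\<^sub>\<le>\<^sub>0" using assms(1) by simp
  have "((\<lambda>t. Ln (1 + of_real (t - a) * z)) has_vector_derivative z / (1 + of_real (t - a) * z))
      (at t within {a..b})" if "t \<in> {a..b}" for t
  proof -
    have "((\<lambda>w. Ln (1 + (w - of_real a) * z)) has_field_derivative z / (1 + of_real (t - a) * z))
        (at (of_real t))"
      using slit[OF that] by (auto intro!: derivative_eq_intros simp: divide_inverse)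
    from has_vector_derivative_real_field[OF this] show ?thesis by simp
  qed
  from fundamental_theorem_of_calculus[OF \<open>a \<le> b\<close> this]
  show "((\<lambda>t. z / (1 + of_real (t - a) * z)) has_integral Ln (1 + of_real (b - a) * z)) {a..b}"
    by simp
qed

text \<open>The integral commutes with whatever commutes with \<open>N\<close>, so each of its
  eigenspaces contains an eigenvector of \<open>N\<close>. There the integrand is scalar and
  integrates to a principal \<open>Ln\<close>, which places the eigenvalue in the strip. As
  \<open>b - a\<close> is nonzero, commuting with \<open>M a b\<close> amounts to commuting with
  \<open>N\<close>, which yields uniqueness of the logarithm.\<close>

lemma
  fixes N :: "complex ^ 'n ^ 'n"
  defines "M \<equiv> \<lambda>a t. mat 1 + (t - a) *\<^sub>R N"
  assumes ab: "a < b" and cont: "continuous_on {a..b} f"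
    and inv: "\<And>t. t \<in> {a..b} \<Longrightarrow> f t ** M a t = mat 1 \<and> M a t ** f t = mat 1"
  shows principal_strip_integral: "principal_strip (integral {a..b} (\<lambda>t. N ** f t))"
    and mlog_eq_integral: "mlog (M a b) = integral {a..b} (\<lambda>t. N ** f t)"
proof -
  let ?Z = "integral {a..b} (\<lambda>t. N ** f t)"
  have int: "(\<lambda>t. N ** f t) integrable_on {a..b}"
    by (intro integrable_continuous_real continuous_intros cont)
  have comm: "Y ** ?Z = ?Z ** Y" if "Y ** N = N ** Y" for Y
  proof -
    have eq: "Y ** (N ** f t) = (N ** f t) ** Y" if t: "t \<in> {a..b}" for t
    proof -
      have YM: "Y ** M a t = M a t ** Y"
        using \<open>Y ** N = N ** Y\<close> by (simp add: M_def matrix_add_ldistrib matrix_add_rdistrib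
            matrix_scalar_ac flip: scalar_matrix_assoc)
      have "Y ** f t = f t ** Y"
        using inv[OF t] YM by (metis matrix_mul_assoc matrix_mul_lid matrix_mul_rid)
      then show ?thesis using \<open>Y ** N = N ** Y\<close> by (metis matrix_mul_assoc)
    qed
    have "Y ** ?Z = integral {a..b} (\<lambda>t. Y ** (N ** f t))"
      using integral_linear[OF int bounded_linear_matrix_mult_right[of Y]] by (simp add: o_def)
    also have "\<dots> = integral {a..b} (\<lambda>t. (N ** f t) ** Y)"
      by (rule integral_cong) (rule eq)
    also have "\<dots> = ?Z ** Y"
      using integral_linear[OF int bounded_linear_matrix_mult_left[of Y]] by (simp add: o_def)
    finally show ?thesis .
  qed
  show strip: "principal_strip ?Z"
  proof (intro allI impI)
    fix z assume "is_eigenvalue ?Z z"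
    then obtain v where v: "v \<noteq> 0" "?Z *v v = z *s v"
      unfolding is_eigenvalue_iff by blast
    let ?S = "{u. ?Z *v u = z *s u}"
    have "vec.subspace ?S"
      by (auto simp: vec.subspace_def matrix_vector_right_distrib vec.scale vec.scale_right_distrib mult.commute)
    moreover have "N *v u \<in> ?S" if "u \<in> ?S" for u
    proof -
      have "?Z *v (N *v u) = N *v (?Z *v u)"
        using comm[OF refl] by (simp add: matrix_vector_mul_assoc)
      then show ?thesis using that by (simp add: vec.scale)
    qed
    ultimately obtain w \<mu> where w: "w \<in> ?S" "w \<noteq> 0" "N *v w = \<mu> *s w"
      using invariant_subspace_eigenvector[of ?S N v] v by blast
    have Mw: "M a t *v w = (1 + of_real (t - a) * \<mu>) *s w" for t
      unfolding M_def matrix_vector_mult_add_rdistrib scaleR_matrix_vector_mult w(3)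
      by (simp add: vec_eq_iff scaleR_conv_of_real[where 'a = complex] algebra_simps)
    have fM: "f t *v (M a t *v w) = w" if "t \<in> {a..b}" for t
      using inv[OF that] by (simp add: matrix_vector_mul_assoc)
    \<comment> \<open>If this scalar vanished, \<open>M a t\<close> would kill \<open>w\<close>,
      although \<open>f t\<close> inverts it.\<close>
    have nz: "1 + of_real (t - a) * \<mu> \<noteq> 0" if "t \<in> {a..b}" for t
      using fM[OF that] Mw[of t] w(2) by (metis matrix_vector_mult_0_right vec.scale_zero_left)
    have Nf: "(N ** f t) *v w = (\<mu> / (1 + of_real (t - a) * \<mu>)) *s w" if "t \<in> {a..b}" for t
    proof -
      have "(1 + of_real (t - a) * \<mu>) *s (f t *v w) = w"
        using fM[OF that] by (simp only: Mw vec.scale)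
      then have "f t *v w = (1 / (1 + of_real (t - a) * \<mu>)) *s w"
        using nz[OF that] by (auto simp: vec_eq_iff field_simps)
      then show ?thesis
        by (simp add: vec.scale w(3) flip: matrix_vector_mul_assoc)
    qed
    note ln = integral_Ln_line[OF less_imp_le[OF ab] nz]
    let ?l = "Ln (1 + of_real (b - a) * \<mu>)"
    have "((\<lambda>t. (\<mu> / (1 + of_real (t - a) * \<mu>)) *s w) has_integral ?l *s w) {a..b}"
      using has_integral_linear[OF ln(2) bounded_linear_vector_scale[of w]] by (simp add: o_def)
    moreover have "((\<lambda>t. (N ** f t) *v w) has_integral ?Z *v w) {a..b}"
      using has_integral_linear[OF integrable_integral[OF int] bounded_linear_matrix_vector[of w]]
      by (simp add: o_def)
    then have "((\<lambda>t. (\<mu> / (1 + of_real (t - a) * \<mu>)) *s w) has_integral ?Z *v w) {a..b}"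
      by (rule has_integral_eq[rotated]) (rule Nf)
    ultimately have "?l *s w = ?Z *v w"
      by (rule has_integral_unique)
    then have "?l *s w = z *s w" using w(1) by simp
    then have "z = ?l" using w(2) by simp
    \<comment> \<open>Strictness of the lower bound \<open>- pi\<close> rests on the argument being
      nonzero, that of the upper bound on its being off the slit.\<close>
    moreover have "1 + of_real (b - a) * \<mu> \<noteq> 0"
      using nz[of b] ab by simp
    ultimately show "- pi < Im z \<and> Im z < pi"
      using ln(1) by (simp add: mpi_less_Im_Ln Im_Ln_less_pi)
  qed
  show "mlog (M a b) = ?Z"
  proof (rule mlog_eqI[OF _ strip])
    show "mexp ?Z = M a b"
      unfolding M_def using ab cont inv[unfolded M_def] by (intro mexp_integral) auto
    fix Y assume "Y ** M a b = M a b ** Y"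
    then have "(b - a) *\<^sub>R (Y ** N) = (b - a) *\<^sub>R (N ** Y)"
      by (simp add: M_def matrix_add_ldistrib matrix_add_rdistrib matrix_scalar_ac
          flip: scalar_matrix_assoc)
    then show "Y ** ?Z = ?Z ** Y" using ab by (intro comm) simp
  qed
qed

subsection \<open>Inverses and eigenvalues of complex matrices\<close>

lemma matrix_inv_mult:
  assumes "invertible A"
  shows "A ** matrix_inv A = mat 1" "matrix_inv A ** A = mat 1"
  using someI_ex[OF assms[unfolded invertible_def]] by (auto simp: matrix_inv_def)

lemma matrix_inv_eqI:
  fixes A B :: "'a::field ^ 'n ^ 'n"
  assumes "A ** B = mat 1"
  shows "matrix_inv A = B"
proof -
  have "B ** A = mat 1" using assms by (rule matrix_left_right_inverse[THEN iffD1])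
  then have "invertible A" using assms by (auto simp: invertible_def)
  then have "matrix_inv A ** (A ** B) = B"
    by (simp add: matrix_mul_assoc matrix_inv_mult)
  then show ?thesis using assms by simp
qed

lemma invertible_matrix_inv:
  assumes "invertible A"
  shows "invertible (matrix_inv A)"
  using matrix_inv_mult[OF assms] by (auto simp: invertible_def)

text \<open>Cramer's rule for each column. As a quotient of determinants the inverse is visibly
  continuous in the entries.\<close>

lemma matrix_inv_cramer:
  fixes A :: "'a::field ^ 'n ^ 'n"
  assumes "invertible A"
  shows "matrix_inv A = (\<chi> i j. det (\<chi> k l. if l = i then axis j 1 $ k else A $ k $ l) / det A)"
proof -
  have "det A \<noteq> 0" using assms by (simp add: invertible_det_nz)
  have "matrix_inv A $ i $ j = det (\<chi> k l. if l = i then axis j 1 $ k else A $ k $ l) / det A" for i j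
  proof -
    have "A *v (matrix_inv A *v axis j 1) = axis j 1"
      using matrix_inv_mult[OF assms] by (simp add: matrix_vector_mul_assoc)
    then have "matrix_inv A *v axis j 1 = (\<chi> i. det (\<chi> k l. if l = i then axis j 1 $ k else A $ k $ l) / det A)"
      by (rule cramer[OF \<open>det A \<noteq> 0\<close>, THEN iffD1])
    from arg_cong[OF this, of "\<lambda>x. x $ i"] show ?thesis
      by (simp add: matrix_vector_mul_axis_nth)
  qed
  then show ?thesis by (simp add: vec_eq_iff)
qed

lemma continuous_on_det [continuous_intros]:
  fixes f :: "'a::topological_space \<Rightarrow> 'b::{real_normed_algebra_1, comm_ring_1} ^ 'n ^ 'n"
  assumes "continuous_on S f"
  shows "continuous_on S (\<lambda>x. det (f x))"
  unfolding det_def by (intro continuous_intros assms)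

lemma continuous_on_matrix_inv [continuous_intros]:
  fixes f :: "'a::topological_space \<Rightarrow> complex ^ 'n ^ 'n"
  assumes f: "continuous_on S f" and inv: "\<And>x. x \<in> S \<Longrightarrow> invertible (f x)"
  shows "continuous_on S (\<lambda>x. matrix_inv (f x))"
proof -
  have "continuous_on S (\<lambda>x. if l = i then axis j 1 $ k else f x $ k $ l)" for i j k l
    by (cases "l = i") (auto intro!: continuous_intros f)
  then have "continuous_on S (\<lambda>x. \<chi> i j. det (\<chi> k l. if l = i then axis j 1 $ k else f x $ k $ l) / det (f x))"
    using inv by (intro continuous_intros f) (auto simp: invertible_det_nz)
  then show ?thesis
    by (rule continuous_on_eq) (simp add: matrix_inv_cramer inv)
qed

lemma open_invertible: "open {A :: complex ^ 'n ^ 'n. invertible A}"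
  unfolding invertible_det_nz
  by (intro open_Collect_neq continuous_intros)

lemma tendsto_matrix_inv [tendsto_intros]:
  fixes f :: "'a \<Rightarrow> complex ^ 'n ^ 'n"
  assumes "(f \<longlongrightarrow> A) F" "invertible A"
  shows "((\<lambda>x. matrix_inv (f x)) \<longlongrightarrow> matrix_inv A) F"
proof -
  have "continuous_on {A :: complex ^ 'n ^ 'n. invertible A} matrix_inv"
    by (intro continuous_intros) auto
  then have "isCont matrix_inv A"
    by (rule continuous_on_interior) (simp add: interior_open open_invertible assms(2))
  then show ?thesis using assms(1) by (rule isCont_tendsto_compose)
qed

text \<open>The eigenvalues are the roots of the characteristic polynomial, which is not the zero
  polynomial because a number beyond the operator norm is not an eigenvalue.\<close>

lemma finite_eigenvalues: "finite {z. is_eigenvalue M z}"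
proof -
  define p where "p = det (\<chi> i j. [:M $ i $ j, if i = j then - 1 else 0:])"
  have p: "poly p z = det (M - csm z (mat 1))" for z
    unfolding p_def det_def
    by (simp add: poly_sum poly_prod csm_def mat_def) (intro sum.cong prod.cong refl arg_cong2[where f = "(*)"], auto)
  have "\<not> is_eigenvalue M (of_real (onorm ((*v) M) + 1))"
  proof
    assume "is_eigenvalue M (of_real (onorm ((*v) M) + 1))"
    then obtain v where v: "v \<noteq> 0" "M *v v = of_real (onorm ((*v) M) + 1) *s v"
      unfolding is_eigenvalue_iff by blast
    then have "M *v v = (onorm ((*v) M) + 1) *\<^sub>R v"
      by (simp add: vec_eq_iff scaleR_conv_of_real[where 'a = complex] algebra_simps)
    then have "norm (M *v v) = (onorm ((*v) M) + 1) * norm v"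
      using onorm_pos_le[of "(*v) M"] by simp
    moreover have "norm (M *v v) \<le> onorm ((*v) M) * norm v"
      by (rule onorm) simp
    ultimately show False using v(1) by (simp add: algebra_simps)
  qed
  then have "p \<noteq> 0" by (metis is_eigenvalue_def p poly_0)
  then show ?thesis
    unfolding is_eigenvalue_def by (simp flip: p add: poly_roots_finite)
qed

text \<open>The exceptional values of \<epsilon> form a finite set, which has no limit point at 0.
  The filter \<open>at 0\<close> leaves out 0 itself, so \<open>M\<close> may be singular.\<close>

lemma eventually_invertible_shift:
  fixes M :: "complex ^ 'n ^ 'n"
  assumes "c \<noteq> 0"
  shows "eventually (\<lambda>\<epsilon>. invertible (M - csm (c * \<epsilon>) (mat 1))) (at 0)"
proof -
  have "finite ((*) c -` {z. is_eigenvalue M z})"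
    using assms by (intro finite_vimageI finite_eigenvalues) (auto simp: inj_on_def)
  then have "eventually (\<lambda>\<epsilon>. \<epsilon> \<notin> (*) c -` {z. is_eigenvalue M z}) (at 0)"
    using islimpt_finite islimpt_iff_eventually by blast
  then show ?thesis
    by (simp add: is_eigenvalue_def invertible_det_nz)
qed

text \<open>Because \<open>mexp X - mat 1\<close> factors as \<open>X ** psi1 X\<close>, the product
  is a left inverse of \<open>psi1 X\<close>. The right-hand side still makes sense when
  \<open>mexp X - mat 1\<close> degenerates in a limit.\<close>

lemma matrix_inv_mexp_minus_1_mult:
  assumes "invertible (mexp X - mat 1)"
  shows "matrix_inv (mexp X - mat 1) ** X = matrix_inv (psi1 X)"
proof -
  have "matrix_inv (mexp X - mat 1) ** X ** psi1 X = mat 1"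
    using matrix_inv_mult(2)[OF assms] by (simp add: mult_psi1 flip: matrix_mul_assoc)
  then show ?thesis
    by (metis matrix_inv_eqI matrix_left_right_inverse)
qed

section \<open>Algebra and continuity of complex scalar multiples\<close>

lemma csm_of_real: "csm (of_real r) M = r *\<^sub>R M"
  by (simp add: csm_def vec_eq_iff scaleR_conv_of_real[where 'a = complex])

lemma csm_csm: "csm c (csm d M) = csm (c * d) M"
  by (simp add: csm_def vec_eq_iff mult.assoc)

lemma csm_simps [simp]:
  "csm 0 M = 0" "csm 1 M = M" "csm c 0 = 0"
  by (simp_all add: csm_def vec_eq_iff)

lemma csm_minus_left: "csm (- c) M = - csm c M"
  by (simp add: csm_def vec_eq_iff)

lemma csm_add: "csm c (M + N) = csm c M + csm c N"
  by (simp add: csm_def vec_eq_iff algebra_simps)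

lemma csm_diff: "csm c (M - N) = csm c M - csm c N"
  by (simp add: csm_def vec_eq_iff algebra_simps)

lemma csm_mult_left: "csm c M ** N = csm c (M ** N)"
  by (simp add: csm_def matrix_matrix_mult_def vec_eq_iff sum_distrib_left mult.assoc)

lemma csm_mult_right: "M ** csm c N = csm c (M ** N)"
  by (simp add: csm_def matrix_matrix_mult_def vec_eq_iff sum_distrib_left mult.left_commute)

lemma bounded_linear_csm: "bounded_linear (csm c)"
  by (intro linear_conv_bounded_linear[THEN iffD1] linearI)
    (simp_all add: csm_def vec_eq_iff algebra_simps)

lemma continuous_on_csm [continuous_intros]:
  assumes "continuous_on S f" "continuous_on S g"
  shows "continuous_on S (\<lambda>x. csm (f x) (g x))"
  unfolding csm_def by (intro continuous_intros assms)

lemma invertible_csm: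
  assumes "c \<noteq> 0"
  shows "invertible (csm c M) \<longleftrightarrow> invertible M"
proof -
  have "csm c M *v v = 0 \<longleftrightarrow> M *v v = 0" for v
    using assms by (simp add: csm_mult_vec)
  then show ?thesis using not_invertible_iff_ker[of M] not_invertible_iff_ker[of "csm c M"] by metis
qed

lemma matrix_inv_csm:
  assumes "c \<noteq> 0" "invertible M"
  shows "matrix_inv (csm c M) = csm (1 / c) (matrix_inv M)"
  by (rule matrix_inv_eqI) (use assms in \<open>simp add: csm_mult_left csm_mult_right csm_csm matrix_inv_mult\<close>)

subsection \<open>Logarithms of quotients in a matrix pencil\<close>

text \<open>Both quotients are affine in t, of the form \<open>mat 1 + (t - a) *\<^sub>R N\<close>,
  where \<open>N\<close> is \<open>Q ** matrix_inv (\<Omega> a)\<close> or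
  \<open>matrix_inv (\<Omega> a) ** Q\<close> according to the order of the factors. The integral
  formula for \<open>mlog\<close> applies, and in its integrand the factors
  \<open>\<Omega> a\<close> cancel.\<close>

lemma
  fixes P Q :: "complex ^ 'n ^ 'n"
  defines "\<Omega> \<equiv> \<lambda>t. t *\<^sub>R Q + P"
  defines "J \<equiv> \<lambda>a b. integral {a..b} (\<lambda>t. matrix_inv (\<Omega> t))"
  assumes ab: "a < b" and inv: "\<And>t. t \<in> {a..b} \<Longrightarrow> invertible (\<Omega> t)"
  shows pencil_strip: "principal_strip (Q ** J a b)"
    and pencil_mexp: "mexp (Q ** J a b) = \<Omega> b ** matrix_inv (\<Omega> a)"
    and pencil_mlog_right: "mlog (\<Omega> b ** matrix_inv (\<Omega> a)) = Q ** J a b"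
    and pencil_mlog_left: "mlog (matrix_inv (\<Omega> a) ** \<Omega> b) = J a b ** Q"
proof -
  have c\<Omega>: "continuous_on S \<Omega>" for S
    unfolding \<Omega>_def by (intro continuous_intros)
  have ci: "continuous_on {a..b} (\<lambda>t. matrix_inv (\<Omega> t))"
    using inv by (intro continuous_intros c\<Omega>) auto
  have int: "(\<lambda>t. matrix_inv (\<Omega> t)) integrable_on {a..b}"
    by (rule integrable_continuous_real[OF ci])
  have inva: "invertible (\<Omega> a)" using inv ab by simp
  note ia = matrix_inv_mult[OF inva]
  have \<Omega>t: "\<Omega> t = \<Omega> a + (t - a) *\<^sub>R Q" for t
    by (simp add: \<Omega>_def algebra_simps)
  define N where "N = Q ** matrix_inv (\<Omega> a)"
  have M: "\<Omega> t ** matrix_inv (\<Omega> a) = mat 1 + (t - a) *\<^sub>R N" for t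
    by (simp add: \<Omega>t[of t] N_def matrix_add_rdistrib ia flip: scalar_matrix_assoc)
  define f where "f t = \<Omega> a ** matrix_inv (\<Omega> t)" for t
  have f: "f t ** (mat 1 + (t - a) *\<^sub>R N) = mat 1 \<and> (mat 1 + (t - a) *\<^sub>R N) ** f t = mat 1"
    if t: "t \<in> {a..b}" for t
  proof
    show "(mat 1 + (t - a) *\<^sub>R N) ** f t = mat 1"
      unfolding M[symmetric] f_def using matrix_inv_mult[OF inv[OF t]] ia
      by (metis matrix_mul_assoc matrix_mul_lid)
    then show "f t ** (mat 1 + (t - a) *\<^sub>R N) = mat 1"
      by (rule matrix_left_right_inverse[THEN iffD1])
  qed
  have cf: "continuous_on {a..b} f"
    unfolding f_def by (intro continuous_intros ci)
  have "N ** f t = Q ** matrix_inv (\<Omega> t)" for t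
    unfolding N_def f_def using ia by (metis matrix_mul_assoc matrix_mul_lid)
  then have Z: "integral {a..b} (\<lambda>t. N ** f t) = Q ** J a b"
    using integral_linear[OF int bounded_linear_matrix_mult_right[of Q]] by (simp add: o_def J_def)
  show "principal_strip (Q ** J a b)"
    unfolding Z[symmetric] by (rule principal_strip_integral[OF ab cf f])
  show "mexp (Q ** J a b) = \<Omega> b ** matrix_inv (\<Omega> a)"
    using mexp_integral[OF less_imp_le[OF ab] cf f] by (simp only: Z M)
  show "mlog (\<Omega> b ** matrix_inv (\<Omega> a)) = Q ** J a b"
    using mlog_eq_integral[OF ab cf f] by (simp only: Z M)
  define N' where "N' = matrix_inv (\<Omega> a) ** Q"
  have M': "matrix_inv (\<Omega> a) ** \<Omega> t = mat 1 + (t - a) *\<^sub>R N'" for t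
    by (simp add: \<Omega>t[of t] N'_def matrix_add_ldistrib ia matrix_scalar_ac flip: scalar_matrix_assoc)
  define f' where "f' t = matrix_inv (\<Omega> t) ** \<Omega> a" for t
  have f': "f' t ** (mat 1 + (t - a) *\<^sub>R N') = mat 1 \<and> (mat 1 + (t - a) *\<^sub>R N') ** f' t = mat 1"
    if t: "t \<in> {a..b}" for t
  proof
    show "f' t ** (mat 1 + (t - a) *\<^sub>R N') = mat 1"
      unfolding M'[symmetric] f'_def using matrix_inv_mult[OF inv[OF t]] ia
      by (metis matrix_mul_assoc matrix_mul_lid)
    then show "(mat 1 + (t - a) *\<^sub>R N') ** f' t = mat 1"
      by (rule matrix_left_right_inverse[THEN iffD1])
  qed
  have cf': "continuous_on {a..b} f'"
    unfolding f'_def by (intro continuous_intros ci)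
  \<comment> \<open>Here \<open>\<Omega> a\<close> cancels only after the factors are swapped, which
    is possible because \<open>N'\<close> commutes with \<open>mat 1 + (t - a) *\<^sub>R N'\<close>
    and so with its inverse \<open>f' t\<close>.\<close>
  have "N' ** f' t = matrix_inv (\<Omega> t) ** Q" if t: "t \<in> {a..b}" for t
  proof -
    let ?m = "mat 1 + (t - a) *\<^sub>R N'"
    have "N' ** ?m = ?m ** N'"
      by (simp add: matrix_add_ldistrib matrix_add_rdistrib matrix_scalar_ac flip: scalar_matrix_assoc)
    then have "N' ** f' t = f' t ** N'"
      using f'[OF t] by (metis matrix_mul_assoc matrix_mul_lid matrix_mul_rid)
    also have "\<dots> = matrix_inv (\<Omega> t) ** Q"
      unfolding N'_def f'_def using ia by (metis matrix_mul_assoc matrix_mul_lid)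
    finally show ?thesis .
  qed
  then have "integral {a..b} (\<lambda>t. N' ** f' t) = integral {a..b} (\<lambda>t. matrix_inv (\<Omega> t) ** Q)"
    by (intro integral_cong) auto
  also have "\<dots> = J a b ** Q"
    using integral_linear[OF int bounded_linear_matrix_mult_left[of Q]] by (simp add: o_def J_def)
  finally show "mlog (matrix_inv (\<Omega> a) ** \<Omega> b) = J a b ** Q"
    using mlog_eq_integral[OF ab cf' f'] by (simp only: M')
qed

text \<open>Near \<epsilon> = 0 both logarithms are products of \<open>Q \<epsilon>\<close> with the
  parameter integral \<open>J a b \<epsilon>\<close>, which is continuous in \<epsilon>. Multiplying
  by \<open>matrix_inv (Q \<epsilon>)\<close> therefore leaves an expression with a limit even if
  \<open>Q 0\<close> is singular. The last identity is proved by cancellation for \<epsilon> with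
  \<open>Q \<epsilon>\<close> invertible and then passed to the limit.\<close>

lemma
  fixes P Q :: "complex \<Rightarrow> complex ^ 'n ^ 'n"
  defines "\<Omega> \<equiv> \<lambda>t \<epsilon>. t *\<^sub>R Q \<epsilon> + P \<epsilon>"
  defines "J \<equiv> \<lambda>a b \<epsilon>. integral {a..b} (\<lambda>t. matrix_inv (\<Omega> t \<epsilon>))"
  defines "Y \<equiv> \<lambda>a b \<epsilon>. mlog (\<Omega> b \<epsilon> ** matrix_inv (\<Omega> a \<epsilon>))"
  assumes ab: "a < b"
    and cont: "continuous_on UNIV P" "continuous_on UNIV Q"
    and inv: "\<And>t. t \<in> {a..b} \<Longrightarrow> invertible (\<Omega> t 0)"
    and Q: "eventually (\<lambda>\<epsilon>. invertible (Q \<epsilon>)) (at 0)"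
  shows pencil_mlog_tendsto: "(Y a b \<longlongrightarrow> Y a b 0) (at 0)"
    and pencil_psi1_tendsto:
      "((\<lambda>\<epsilon>. matrix_inv (mexp (Y a b \<epsilon>) - mat 1) ** Y a b \<epsilon>) \<longlongrightarrow> matrix_inv (psi1 (Y a b 0))) (at 0)"
    and pencil_integral_tendsto_right: "((\<lambda>\<epsilon>. matrix_inv (Q \<epsilon>) ** Y a b \<epsilon>) \<longlongrightarrow> J a b 0) (at 0)"
    and pencil_integral_tendsto_left:
      "((\<lambda>\<epsilon>. mlog (matrix_inv (\<Omega> a \<epsilon>) ** \<Omega> b \<epsilon>) ** matrix_inv (Q \<epsilon>)) \<longlongrightarrow> J a b 0) (at 0)"
    and pencil_mult_integral:
      "P 0 ** J a b 0 = matrix_inv (psi1 (Y a b 0)) ** (b *\<^sub>R mat 1 - a *\<^sub>R mexp (Y a b 0))"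
proof -
  have cPQ: "continuous_on S (\<lambda>x. P (g x))" "continuous_on S (\<lambda>x. Q (g x))" if "continuous_on S g" for S g
    using that cont by (auto intro: continuous_on_compose2)
  have c\<Omega>: "continuous_on S (\<lambda>x. \<Omega> (h x) (g x))" if "continuous_on S g" "continuous_on S h"
    for S and h :: "complex \<times> real \<Rightarrow> real" and g
    unfolding \<Omega>_def by (intro continuous_intros cPQ that)
  have "continuous_on UNIV (\<lambda>x::complex \<times> real. \<Omega> (snd x) (fst x))"
    by (intro c\<Omega> continuous_intros)
  from open_vimage[OF open_invertible this]
  have op: "open {x::complex \<times> real. invertible (\<Omega> (snd x) (fst x))}"
    by (simp add: vimage_def)
  have "{0} \<times> {a..b} \<subseteq> {x. invertible (\<Omega> (snd x) (fst x))}"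
    using inv by auto
  \<comment> \<open>Compactness of \<open>{a..b}\<close> gives one neighbourhood of \<epsilon> = 0
    that works for all \<open>t\<close> at once.\<close>
  from Elementary_Topology.tube_lemma[OF compact_Icc op this]
  obtain U where U: "0 \<in> U" "open U"
    and sub: "U \<times> {a..b} \<subseteq> {x. invertible (\<Omega> (snd x) (fst x))}"
    by auto
  have U_inv: "invertible (\<Omega> t \<epsilon>)" if "\<epsilon> \<in> U" "t \<in> {a..b}" for t \<epsilon>
    using subsetD[OF sub, of "(\<epsilon>, t)"] that by simp
  have evU: "eventually (\<lambda>\<epsilon>. \<epsilon> \<in> U) (at 0)"
    using U by (auto simp: eventually_at_topological)
  have "continuous_on U (\<lambda>\<epsilon>. integral (cbox a b) (\<lambda>t. matrix_inv (\<Omega> t \<epsilon>)))"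
    by (rule integral_continuous_on_param)
      (auto simp: split_beta intro!: continuous_on_matrix_inv c\<Omega> continuous_intros U_inv)
  then have "isCont (J a b) 0"
    using U by (simp add: J_def continuous_on_eq_continuous_at)
  then have J: "(J a b \<longlongrightarrow> J a b 0) (at 0)"
    by (simp add: isCont_def)
  have limQ: "(Q \<longlongrightarrow> Q 0) (at 0)" and limP: "(P \<longlongrightarrow> P 0) (at 0)"
    using cont by (auto simp: continuous_on_def)
  have YU: "Y a b \<epsilon> = Q \<epsilon> ** J a b \<epsilon>" if "\<epsilon> \<in> U" for \<epsilon>
    using pencil_mlog_right[of a b "Q \<epsilon>" "P \<epsilon>"] ab U_inv[OF that]
    by (simp add: Y_def J_def \<Omega>_def)
  have Y'U: "mlog (matrix_inv (\<Omega> a \<epsilon>) ** \<Omega> b \<epsilon>) = J a b \<epsilon> ** Q \<epsilon>" if "\<epsilon> \<in> U" for \<epsilon>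
    using pencil_mlog_left[of a b "Q \<epsilon>" "P \<epsilon>"] ab U_inv[OF that]
    by (simp add: J_def \<Omega>_def)
  have expU: "mexp (Y a b \<epsilon>) = \<Omega> b \<epsilon> ** matrix_inv (\<Omega> a \<epsilon>)" if "\<epsilon> \<in> U" for \<epsilon>
    using pencil_mexp[of a b "Q \<epsilon>" "P \<epsilon>"] ab U_inv[OF that]
    by (simp add: YU[OF that] J_def \<Omega>_def)
  have stripU: "principal_strip (Y a b \<epsilon>)" if "\<epsilon> \<in> U" for \<epsilon>
    using pencil_strip[of a b "Q \<epsilon>" "P \<epsilon>"] ab U_inv[OF that]
    unfolding YU[OF that] J_def \<Omega>_def by blast
  have ev: "eventually (\<lambda>\<epsilon>. \<epsilon> \<in> U \<and> invertible (Q \<epsilon>)) (at 0)"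
    using evU Q by (rule eventually_conj)
  have "((\<lambda>\<epsilon>. Q \<epsilon> ** J a b \<epsilon>) \<longlongrightarrow> Y a b 0) (at 0)"
    unfolding YU[OF U(1)] by (intro tendsto_intros limQ J)
  then show limY: "(Y a b \<longlongrightarrow> Y a b 0) (at 0)"
    by (rule Lim_transform_eventually) (use evU YU in \<open>auto elim: eventually_mono\<close>)
  \<comment> \<open>This matrix equals \<open>(b - a) *\<^sub>R (Q \<epsilon> ** matrix_inv
    (\<Omega> a \<epsilon>))\<close>, so it inherits invertibility from
    \<open>Q \<epsilon>\<close>.\<close>
  have invertible_exp: "invertible (mexp (Y a b \<epsilon>) - mat 1)" if "\<epsilon> \<in> U" "invertible (Q \<epsilon>)" for \<epsilon>
  proof -
    have inva: "invertible (\<Omega> a \<epsilon>)" using U_inv[OF that(1)] ab by simp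
    have "\<Omega> b \<epsilon> = \<Omega> a \<epsilon> + (b - a) *\<^sub>R Q \<epsilon>" by (simp add: \<Omega>_def algebra_simps)
    then have "mexp (Y a b \<epsilon>) - mat 1 = (b - a) *\<^sub>R (Q \<epsilon> ** matrix_inv (\<Omega> a \<epsilon>))"
      using matrix_inv_mult(1)[OF inva]
      by (simp add: expU[OF that(1)] matrix_add_rdistrib flip: scalar_matrix_assoc)
    then show ?thesis
      using ab by (simp add: scalar_invertible invertible_mult invertible_matrix_inv inva that(2))
  qed
  have limpsi: "((\<lambda>\<epsilon>. psi1 (Y a b \<epsilon>)) \<longlongrightarrow> psi1 (Y a b 0)) (at 0)"
    by (rule isCont_tendsto_compose[OF isCont_psi1 limY])
  have "((\<lambda>\<epsilon>. matrix_inv (psi1 (Y a b \<epsilon>))) \<longlongrightarrow> matrix_inv (psi1 (Y a b 0))) (at 0)"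
    by (intro tendsto_matrix_inv limpsi invertible_psi1 stripU U)
  then show limL: "((\<lambda>\<epsilon>. matrix_inv (mexp (Y a b \<epsilon>) - mat 1) ** Y a b \<epsilon>) \<longlongrightarrow>
      matrix_inv (psi1 (Y a b 0))) (at 0)"
    by (rule Lim_transform_eventually)
      (use ev in eventually_elim, simp add: matrix_inv_mexp_minus_1_mult invertible_exp)
  show "((\<lambda>\<epsilon>. matrix_inv (Q \<epsilon>) ** Y a b \<epsilon>) \<longlongrightarrow> J a b 0) (at 0)"
    by (rule Lim_transform_eventually[OF J])
      (use ev in eventually_elim, simp add: YU matrix_mul_assoc matrix_inv_mult)
  show "((\<lambda>\<epsilon>. mlog (matrix_inv (\<Omega> a \<epsilon>) ** \<Omega> b \<epsilon>) ** matrix_inv (Q \<epsilon>)) \<longlongrightarrow> J a b 0) (at 0)"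
    by (rule Lim_transform_eventually[OF J])
      (use ev in eventually_elim, simp add: Y'U matrix_inv_mult flip: matrix_mul_assoc)
  let ?D = "\<lambda>\<epsilon>. mexp (Y a b \<epsilon>) - mat 1"
  \<comment> \<open>Since \<open>?e\<close> carries \<open>\<Omega> a \<epsilon>\<close> to
    \<open>\<Omega> b \<epsilon>\<close>, the product \<open>?D \<epsilon> ** P \<epsilon>\<close>
    involves only \<open>Q \<epsilon>\<close> and \<open>?e ** Q \<epsilon>\<close>; multiplying by
    \<open>J a b \<epsilon>\<close> turns \<open>Q \<epsilon>\<close> into the logarithm.\<close>
  have key: "P \<epsilon> ** J a b \<epsilon> = (matrix_inv (?D \<epsilon>) ** Y a b \<epsilon>) ** (b *\<^sub>R mat 1 - a *\<^sub>R mexp (Y a b \<epsilon>))"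
    if \<epsilon>: "\<epsilon> \<in> U" "invertible (Q \<epsilon>)" for \<epsilon>
  proof -
    let ?e = "mexp (Y a b \<epsilon>)"
    have inva: "invertible (\<Omega> a \<epsilon>)" using U_inv[OF \<epsilon>(1)] ab by simp
    have P: "P \<epsilon> = \<Omega> a \<epsilon> - a *\<^sub>R Q \<epsilon>" by (simp add: \<Omega>_def)
    have "?e ** \<Omega> a \<epsilon> = \<Omega> b \<epsilon>"
      using matrix_inv_mult(2)[OF inva] by (simp add: expU[OF \<epsilon>(1)] flip: matrix_mul_assoc)
    then have "?e ** P \<epsilon> = \<Omega> b \<epsilon> - a *\<^sub>R (?e ** Q \<epsilon>)"
      by (simp add: P matrix_diff_ldistrib matrix_scalar_ac flip: scalar_matrix_assoc)
    then have "?D \<epsilon> ** P \<epsilon> = b *\<^sub>R Q \<epsilon> - a *\<^sub>R (?e ** Q \<epsilon>)"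
      by (simp add: matrix_diff_rdistrib) (simp add: \<Omega>_def)
    then have "?D \<epsilon> ** (P \<epsilon> ** J a b \<epsilon>) = b *\<^sub>R Y a b \<epsilon> - a *\<^sub>R (?e ** Y a b \<epsilon>)"
      by (simp add: YU[OF \<epsilon>(1)] matrix_mul_assoc matrix_diff_rdistrib flip: scalar_matrix_assoc)
    also have "\<dots> = Y a b \<epsilon> ** (b *\<^sub>R mat 1 - a *\<^sub>R ?e)"
      by (simp add: matrix_diff_ldistrib matrix_scalar_ac mexp_commutes[OF refl] flip: scalar_matrix_assoc)
    finally have "matrix_inv (?D \<epsilon>) ** (?D \<epsilon> ** (P \<epsilon> ** J a b \<epsilon>)) =
        matrix_inv (?D \<epsilon>) ** (Y a b \<epsilon> ** (b *\<^sub>R mat 1 - a *\<^sub>R ?e))"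
      by simp
    then show ?thesis
      using matrix_inv_mult(2)[OF invertible_exp[OF \<epsilon>]] by (simp add: matrix_mul_assoc)
  qed
  have "((\<lambda>\<epsilon>. \<Omega> b \<epsilon> ** matrix_inv (\<Omega> a \<epsilon>)) \<longlongrightarrow> \<Omega> b 0 ** matrix_inv (\<Omega> a 0)) (at 0)"
    unfolding \<Omega>_def using inv[of a] ab by (intro tendsto_intros limP limQ) (simp add: \<Omega>_def)
  then have "((\<lambda>\<epsilon>. mexp (Y a b \<epsilon>)) \<longlongrightarrow> mexp (Y a b 0)) (at 0)"
    unfolding expU[OF U(1)]
    by (rule Lim_transform_eventually) (use evU in eventually_elim, simp add: expU)
  then have "((\<lambda>\<epsilon>. (matrix_inv (?D \<epsilon>) ** Y a b \<epsilon>) ** (b *\<^sub>R mat 1 - a *\<^sub>R mexp (Y a b \<epsilon>))) \<longlongrightarrow>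
      matrix_inv (psi1 (Y a b 0)) ** (b *\<^sub>R mat 1 - a *\<^sub>R mexp (Y a b 0))) (at 0)"
    by (intro tendsto_intros limL)
  then have "((\<lambda>\<epsilon>. P \<epsilon> ** J a b \<epsilon>) \<longlongrightarrow>
      matrix_inv (psi1 (Y a b 0)) ** (b *\<^sub>R mat 1 - a *\<^sub>R mexp (Y a b 0))) (at 0)"
    by (rule Lim_transform_eventually) (use ev in eventually_elim, simp add: key)
  moreover have "((\<lambda>\<epsilon>. P \<epsilon> ** J a b \<epsilon>) \<longlongrightarrow> P 0 ** J a b 0) (at 0)"
    by (intro tendsto_intros limP J)
  ultimately show "P 0 ** J a b 0 =
      matrix_inv (psi1 (Y a b 0)) ** (b *\<^sub>R mat 1 - a *\<^sub>R mexp (Y a b 0))"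
    using tendsto_unique trivial_limit_at by blast
qed

section \<open>Integral of the resolvent along a segment of the imaginary axis\<close>

theorem theorem5:
  fixes A E :: "real ^ 'n ^ 'n"
    and \<alpha> \<beta> :: complex
    and \<omega>1 \<omega>2 :: real
    and K :: "complex \<Rightarrow> complex ^ 'n ^ 'n"
    and W :: "complex ^ 'n ^ 'n"
    and A\<^sub>\<epsilon> E\<^sub>\<epsilon> :: "complex \<Rightarrow> complex ^ 'n ^ 'n"
    and \<Omega> :: "real \<Rightarrow> complex \<Rightarrow> complex ^ 'n ^ 'n"
    and Y\<^sub>\<epsilon> :: "complex \<Rightarrow> complex ^ 'n ^ 'n"
    and Y L :: "complex ^ 'n ^ 'n"
  defines "K \<equiv> (\<lambda>s. matrix_inv (csm s (cmat E) - cmat A))"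
    and "W \<equiv> csm \<alpha> (cmat E) + csm \<beta> (cmat A)"
    and "A\<^sub>\<epsilon> \<equiv> (\<lambda>\<epsilon>. cmat A + csm (\<alpha> * \<epsilon>) (mat 1))"
    and "E\<^sub>\<epsilon> \<equiv> (\<lambda>\<epsilon>. cmat E - csm (\<beta> * \<epsilon>) (mat 1))"
    and "\<Omega> \<equiv> (\<lambda>\<omega> \<epsilon>. csm (complex_of_real \<omega>) (E\<^sub>\<epsilon> \<epsilon>) + csm \<i> (A\<^sub>\<epsilon> \<epsilon>))"
    and "Y\<^sub>\<epsilon> \<equiv> (\<lambda>\<epsilon>. mlog (\<Omega> \<omega>2 \<epsilon> ** matrix_inv (\<Omega> \<omega>1 \<epsilon>)))"
    and "Y \<equiv> mlog (\<Omega> \<omega>2 0 ** matrix_inv (\<Omega> \<omega>1 0))"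
    and "L \<equiv> matrix_inv (psi1 Y)"
  assumes regular: "pencil_regular (cmat A) (cmat E)"
    and W_inv: "invertible W"
    and interval: "\<omega>1 < \<omega>2"
    and no_eig: "\<forall>w\<in>{\<omega>1..\<omega>2}. \<not> pencil_eigenvalue (cmat A) (cmat E) (\<i> * complex_of_real w)"
  shows "(Y\<^sub>\<epsilon> \<longlongrightarrow> Y) (at 0)
    \<and> ((\<lambda>\<epsilon>. matrix_inv (mexp (Y\<^sub>\<epsilon> \<epsilon>) - mat 1) ** Y\<^sub>\<epsilon> \<epsilon>) \<longlongrightarrow> L) (at 0)
    \<and> ((\<lambda>\<omega>. K (\<i> * complex_of_real \<omega>)) has_integral
         - (matrix_inv W ** (csm \<beta> (L ** (csm (complex_of_real \<omega>2) (mat 1)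
                                   - csm (complex_of_real \<omega>1) (mexp Y)))
                             + csm (\<i> * \<alpha>) Y))) {\<omega>1..\<omega>2}
    \<and> ((\<lambda>\<epsilon>. csm (1 / \<i>) (matrix_inv (E\<^sub>\<epsilon> \<epsilon>) ** mlog (\<Omega> \<omega>2 \<epsilon> ** matrix_inv (\<Omega> \<omega>1 \<epsilon>))))
         \<longlongrightarrow> integral {\<omega>1..\<omega>2} (\<lambda>\<omega>. K (\<i> * complex_of_real \<omega>))) (at 0)
    \<and> ((\<lambda>\<epsilon>. csm (1 / \<i>) (mlog (matrix_inv (\<Omega> \<omega>1 \<epsilon>) ** \<Omega> \<omega>2 \<epsilon>) ** matrix_inv (E\<^sub>\<epsilon> \<epsilon>)))
         \<longlongrightarrow> integral {\<omega>1..\<omega>2} (\<lambda>\<omega>. K (\<i> * complex_of_real \<omega>))) (at 0)"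
proof -
  define J where "J = integral {\<omega>1..\<omega>2} (\<lambda>t. matrix_inv (\<Omega> t 0))"
  have \<Omega>: "\<Omega> t \<epsilon> = t *\<^sub>R E\<^sub>\<epsilon> \<epsilon> + csm \<i> (A\<^sub>\<epsilon> \<epsilon>)" for t \<epsilon>
    by (simp add: \<Omega>_def csm_of_real)
  \<comment> \<open>In this form the absence of eigenvalues on the segment says exactly that
    \<open>\<Omega> t 0\<close> is invertible.\<close>
  have \<Omega>0: "\<Omega> t 0 = csm \<i> (cmat A - csm (\<i> * of_real t) (cmat E))" for t
    by (simp add: \<Omega>_def E\<^sub>\<epsilon>_def A\<^sub>\<epsilon>_def csm_diff csm_csm csm_minus_left)
  have inv: "invertible (\<Omega> t 0)" if "t \<in> {\<omega>1..\<omega>2}" for t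
    using no_eig that unfolding \<Omega>0 pencil_eigenvalue_def
    by (subst invertible_csm) (simp_all add: invertible_det_nz)
  have cont: "continuous_on UNIV (\<lambda>\<epsilon>. csm \<i> (A\<^sub>\<epsilon> \<epsilon>))" "continuous_on UNIV E\<^sub>\<epsilon>"
    unfolding A\<^sub>\<epsilon>_def E\<^sub>\<epsilon>_def by (intro continuous_intros)+
  \<comment> \<open>For \<beta> = 0 there is no shift, and \<open>W\<close> is \<alpha> times
    \<open>cmat E\<close>, whose invertibility follows; otherwise small nonzero shifts avoid the
    spectrum of \<open>cmat E\<close>.\<close>
  have evE: "eventually (\<lambda>\<epsilon>. invertible (E\<^sub>\<epsilon> \<epsilon>)) (at 0)"
  proof (cases "\<beta> = 0")
    case True
    then have "invertible (csm \<alpha> (cmat E))" using W_inv by (simp add: W_def)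
    then have "invertible (cmat E)"
      using not_invertible_iff_ker[of "cmat E"] not_invertible_iff_ker[of "csm \<alpha> (cmat E)"]
      by (auto simp: csm_mult_vec)
    then show ?thesis using True by (simp add: E\<^sub>\<epsilon>_def)
  next
    case False
    then show ?thesis unfolding E\<^sub>\<epsilon>_def by (rule eventually_invertible_shift)
  qed
  note pencil = interval cont inv[unfolded \<Omega>] evE
  have K: "K (\<i> * of_real t) = csm (1 / \<i>) (matrix_inv (\<Omega> t 0))" if "t \<in> {\<omega>1..\<omega>2}" for t
  proof -
    have "csm (\<i> * of_real t) (cmat E) - cmat A = csm \<i> (\<Omega> t 0)"
      by (simp add: \<Omega>0 csm_csm csm_minus_left)
    then show ?thesis using inv[OF that] by (simp add: K_def matrix_inv_csm)
  qed
  have "continuous_on {\<omega>1..\<omega>2} (\<lambda>t. matrix_inv (\<Omega> t 0))"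
    unfolding \<Omega> using inv[unfolded \<Omega>] by (intro continuous_intros) auto
  then have "((\<lambda>t. matrix_inv (\<Omega> t 0)) has_integral J) {\<omega>1..\<omega>2}"
    unfolding J_def by (intro integrable_integral integrable_continuous_real)
  from has_integral_linear[OF this bounded_linear_csm[of "1 / \<i>"]]
  have hasK: "((\<lambda>\<omega>. K (\<i> * of_real \<omega>)) has_integral csm (1 / \<i>) J) {\<omega>1..\<omega>2}"
    by (rule has_integral_eq[rotated]) (simp add: K)
  have intK: "integral {\<omega>1..\<omega>2} (\<lambda>\<omega>. K (\<i> * of_real \<omega>)) = csm (1 / \<i>) J"
    using hasK by (rule integral_unique)
  have limY: "(Y\<^sub>\<epsilon> \<longlongrightarrow> Y) (at 0)"
    using pencil_mlog_tendsto[OF pencil] by (simp add: Y\<^sub>\<epsilon>_def Y_def flip: \<Omega>)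
  have limL: "((\<lambda>\<epsilon>. matrix_inv (mexp (Y\<^sub>\<epsilon> \<epsilon>) - mat 1) ** Y\<^sub>\<epsilon> \<epsilon>) \<longlongrightarrow> L) (at 0)"
    using pencil_psi1_tendsto[OF pencil] by (simp add: Y\<^sub>\<epsilon>_def Y_def L_def flip: \<Omega>)
  have right: "((\<lambda>\<epsilon>. csm (1 / \<i>) (matrix_inv (E\<^sub>\<epsilon> \<epsilon>) ** mlog (\<Omega> \<omega>2 \<epsilon> ** matrix_inv (\<Omega> \<omega>1 \<epsilon>))))
      \<longlongrightarrow> csm (1 / \<i>) J) (at 0)"
    using pencil_integral_tendsto_right[OF pencil]
    by (intro bounded_linear.tendsto[OF bounded_linear_csm]) (simp add: J_def flip: \<Omega>)
  have left: "((\<lambda>\<epsilon>. csm (1 / \<i>) (mlog (matrix_inv (\<Omega> \<omega>1 \<epsilon>) ** \<Omega> \<omega>2 \<epsilon>) ** matrix_inv (E\<^sub>\<epsilon> \<epsilon>)))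
      \<longlongrightarrow> csm (1 / \<i>) J) (at 0)"
    using pencil_integral_tendsto_left[OF pencil]
    by (intro bounded_linear.tendsto[OF bounded_linear_csm]) (simp add: J_def flip: \<Omega>)
  have AJ: "csm \<i> (A\<^sub>\<epsilon> 0) ** J = L ** (\<omega>2 *\<^sub>R mat 1 - \<omega>1 *\<^sub>R mexp Y)"
    using pencil_mult_integral[OF pencil] by (simp add: Y_def L_def J_def flip: \<Omega>)
  have EJ: "Y = E\<^sub>\<epsilon> 0 ** J"
    using pencil_mlog_right[OF interval inv[unfolded \<Omega>]] by (simp add: Y_def J_def flip: \<Omega>)
  \<comment> \<open>Expand \<open>W ** J\<close> into its \<alpha> and \<beta> parts:
    \<open>EJ\<close> evaluates the first as \<open>Y\<close>, \<open>AJ\<close> the second up to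
    the factor \<i>.\<close>
  have "csm \<beta> (L ** (csm (of_real \<omega>2) (mat 1) - csm (of_real \<omega>1) (mexp Y))) + csm (\<i> * \<alpha>) Y =
      csm \<i> (W ** J)"
    by (simp add: csm_of_real flip: AJ)
      (simp add: EJ W_def A\<^sub>\<epsilon>_def E\<^sub>\<epsilon>_def csm_mult_left csm_csm csm_add matrix_add_rdistrib ac_simps)
  then have "matrix_inv W ** (csm \<beta> (L ** (csm (of_real \<omega>2) (mat 1) - csm (of_real \<omega>1) (mexp Y))) + csm (\<i> * \<alpha>) Y)
      = csm \<i> J"
    using matrix_inv_mult(2)[OF W_inv] by (simp add: csm_mult_right matrix_mul_assoc)
  \<comment> \<open>The sign in the closed form comes from - \<i> = 1 / \<i>.\<close>
  then have "- (matrix_inv W ** (csm \<beta> (L ** (csm (of_real \<omega>2) (mat 1) - csm (of_real \<omega>1) (mexp Y))) + csm (\<i> * \<alpha>) Y))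
      = csm (1 / \<i>) J"
    by (simp add: csm_minus_left)
  then show ?thesis
    using limY limL hasK right left by (simp only: intK simp_thms)
qed

end
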